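(* Let $(M,\mathbf g)$ be a $4$-dimensional static spherically symmetric space-time with metric locally of the form $$\mathbf g=g_{00}(dx^0)^2+2g_{01}\,dx^0dx^1+g_{11}(dx^1)^2+g_{\theta\theta}\,(d\theta^2+\sin^2\theta\,d\phi^2)$$ in coordinates $(x^0,x^1,\theta,\phi)$ adapted to the spherical symmetry, where $g_{00},g_{01},g_{11},g_{\theta\theta}>0$ depend only on $x^0,x^1$, and $g_{\theta\theta}$ is a function of a scalar $r$ (depending only on $x^0,x^1$) alone. Let $S$ be an $SO(3)\times\mathbb R$-invariant timelike hypersurface of $(M,\mathbf g)$ and suppose that $\nabla r$ is nowhere zero along $S$. Then $S$ is an $SO(3)\times\mathbb R$-invariant photon surface of $(M,\mathbf g)$ if and only if $$2g_{\theta\theta}\,\epsilon^{ab}\epsilon^{cd}r_{;ac}r_{;b}r_{;d}+r^{;a}r_{;a}\,r^{;c}\partial_c g_{\theta\theta}=0$$ holds along $S$.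
   Context: A static spherically symmetric space-time is one admitting an $SO(3)\times\mathbb R$ group of isometries, where the $SO(3)$ orbits are spacelike $2$-spheres and the $\mathbb R$ orbits are generated by a Killing field that is hypersurface orthogonal and orthogonal to the $SO(3)$ orbits. A hypersurface is $G$-invariant if each element of $G$ maps it onto itself. A photon surface of $(M,\mathbf g)$ is an immersed, nowhere-spacelike hypersurface $S$ such that for every $p\in S$ and every null vector $\mathbf k\in T_pS$ there exists a null geodesic $\gamma:(-\epsilon,\epsilon)\to M$ of $(M,\mathbf g)$ with $\dot\gamma(0)=\mathbf k$ and image contained in $S$. The tensor $\epsilon^{ab}$ has, in the coordinate basis above, components $\epsilon^{01}=-\epsilon^{10}=(-\Delta)^{-1/2}$ and all others zero, where $\Delta=g_{00}g_{11}-(g_{01})^2$. Semicolons denote the Levi-Civita covariant derivative of $\mathbf g$, indices raised with $\mathbf g$.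
   Formalization: The scalar r is assumed invariant under the static Killing flow (without this the claim fails, e.g. for constant g_θθ), and M is taken to be one coordinate patch adapted to the symmetry, with invariance stated in that patch; the global case follows by covering M with such patches. *)

theory Defs
  imports "HOL-Analysis.Analysis"
begin

fun Ck :: "nat \<Rightarrow> 'a::euclidean_space set \<Rightarrow> ('a \<Rightarrow> real) \<Rightarrow> bool" where
  "Ck 0 A f = continuous_on A f"
| "Ck (Suc k) A f = (f differentiable_on A \<and>
      (\<forall>b\<in>Basis. Ck k A (\<lambda>x. frechet_derivative f (at x) b)))"

definition smooth_fun :: "'a::euclidean_space set \<Rightarrow> ('a \<Rightarrow> real) \<Rightarrow> bool" where
  "smooth_fun A f \<longleftrightarrow> (\<forall>k. Ck k A f)"

section \<open>Coordinates (x^0,x^1,theta,phi) = (p$1,p$2,p$3,p$4) on real^4\<close>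

definition partial :: "4 \<Rightarrow> (real^4 \<Rightarrow> real) \<Rightarrow> real^4 \<Rightarrow> real" where
  "partial i f p = frechet_derivative f (at p) (axis i 1)"

definition lift2 :: "(real \<times> real \<Rightarrow> real) \<Rightarrow> real^4 \<Rightarrow> real" where
  "lift2 f p = f (p$1, p$2)"

definition chartdom :: "(real \<times> real) set \<Rightarrow> (real^4) set" where
  "chartdom D = {p. (p$1, p$2) \<in> D \<and> 0 < p$3 \<and> p$3 < pi}"

definition sss_metric ::
  "(real \<times> real \<Rightarrow> real) \<Rightarrow> (real \<times> real \<Rightarrow> real) \<Rightarrow> (real \<times> real \<Rightarrow> real) \<Rightarrow>
   (real \<times> real \<Rightarrow> real) \<Rightarrow> real^4 \<Rightarrow> real^4^4" where
  "sss_metric g00 g01 g11 gth p = (\<chi> i. \<chi> j.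
     if i = 1 \<and> j = 1 then lift2 g00 p
     else if (i = 1 \<and> j = 2) \<or> (i = 2 \<and> j = 1) then lift2 g01 p
     else if i = 2 \<and> j = 2 then lift2 g11 p
     else if i = 3 \<and> j = 3 then lift2 gth p
     else if i = 4 \<and> j = 4 then lift2 gth p * (sin (p$3))\<^sup>2
     else 0)"

definition gform :: "(real^4 \<Rightarrow> real^4^4) \<Rightarrow> real^4 \<Rightarrow> real^4 \<Rightarrow> real^4 \<Rightarrow> real" where
  "gform G p v w = (\<Sum>i\<in>UNIV. \<Sum>j\<in>UNIV. G p $ i $ j * v $ i * w $ j)"

definition ginv :: "(real^4 \<Rightarrow> real^4^4) \<Rightarrow> real^4 \<Rightarrow> 4 \<Rightarrow> 4 \<Rightarrow> real" where
  "ginv G p i j = matrix_inv (G p) $ i $ j"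

definition christoffel :: "(real^4 \<Rightarrow> real^4^4) \<Rightarrow> real^4 \<Rightarrow> 4 \<Rightarrow> 4 \<Rightarrow> 4 \<Rightarrow> real" where
  "christoffel G p k i j =
     (\<Sum>l\<in>UNIV. ginv G p k l *
        (partial i (\<lambda>q. G q $ j $ l) p + partial j (\<lambda>q. G q $ i $ l) p
         - partial l (\<lambda>q. G q $ i $ j) p)) / 2"

definition geodesic :: "(real^4 \<Rightarrow> real^4^4) \<Rightarrow> (real^4) set \<Rightarrow> real set \<Rightarrow> (real \<Rightarrow> real^4) \<Rightarrow> bool" where
  "geodesic G U J \<gamma> \<longleftrightarrow>
     (\<exists>\<gamma>' \<gamma>''. \<forall>t\<in>J. \<gamma> t \<in> U \<and>
        (\<gamma> has_vector_derivative \<gamma>' t) (at t) \<and>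
        (\<gamma>' has_vector_derivative \<gamma>'' t) (at t) \<and>
        (\<forall>k. \<gamma>'' t $ k + (\<Sum>i\<in>UNIV. \<Sum>j\<in>UNIV.
              christoffel G (\<gamma> t) k i j * \<gamma>' t $ i * \<gamma>' t $ j) = 0))"

definition immersed_hypersurface :: "(real^4) set \<Rightarrow> (real^3 \<Rightarrow> real^4) \<Rightarrow> (real^3) set \<Rightarrow> bool" where
  "immersed_hypersurface U \<Phi> V \<longleftrightarrow> open V \<and> \<Phi> ` V \<subseteq> U \<and>
     (\<forall>i. smooth_fun V (\<lambda>u. \<Phi> u $ i)) \<and>
     (\<forall>u\<in>V. \<Phi> differentiable (at u) \<and> inj (frechet_derivative \<Phi> (at u)))"

definition tangent_space :: "(real^3 \<Rightarrow> real^4) \<Rightarrow> real^3 \<Rightarrow> (real^4) set" where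
  "tangent_space \<Phi> u = range (frechet_derivative \<Phi> (at u))"

definition timelike_hypersurface ::
  "(real^4 \<Rightarrow> real^4^4) \<Rightarrow> (real^4) set \<Rightarrow> (real^3 \<Rightarrow> real^4) \<Rightarrow> (real^3) set \<Rightarrow> bool" where
  "timelike_hypersurface G U \<Phi> V \<longleftrightarrow> immersed_hypersurface U \<Phi> V \<and>
     (\<forall>u\<in>V. \<exists>v\<in>tangent_space \<Phi> u. gform G (\<Phi> u) v v < 0)"

definition nowhere_spacelike ::
  "(real^4 \<Rightarrow> real^4^4) \<Rightarrow> (real^3 \<Rightarrow> real^4) \<Rightarrow> (real^3) set \<Rightarrow> bool" where
  "nowhere_spacelike G \<Phi> V \<longleftrightarrow>
     (\<forall>u\<in>V. \<exists>v\<in>tangent_space \<Phi> u. v \<noteq> 0 \<and> gform G (\<Phi> u) v v \<le> 0)"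

definition photon_surface ::
  "(real^4 \<Rightarrow> real^4^4) \<Rightarrow> (real^4) set \<Rightarrow> (real^3 \<Rightarrow> real^4) \<Rightarrow> (real^3) set \<Rightarrow> bool" where
  "photon_surface G U \<Phi> V \<longleftrightarrow> immersed_hypersurface U \<Phi> V \<and> nowhere_spacelike G \<Phi> V \<and>
     (\<forall>u\<in>V. \<forall>k\<in>tangent_space \<Phi> u. k \<noteq> 0 \<and> gform G (\<Phi> u) k k = 0 \<longrightarrow>
        (\<exists>\<epsilon>>0. \<exists>\<gamma>. geodesic G U {-\<epsilon><..<\<epsilon>} \<gamma> \<and> \<gamma> 0 = \<Phi> u \<and>
            (\<gamma> has_vector_derivative k) (at 0) \<and> \<gamma> ` {-\<epsilon><..<\<epsilon>} \<subseteq> \<Phi> ` V))"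

definition killing_field :: "(real^4 \<Rightarrow> real^4^4) \<Rightarrow> (real^4) set \<Rightarrow> (real^4 \<Rightarrow> real^4) \<Rightarrow> bool" where
  "killing_field G U X \<longleftrightarrow> (\<forall>p\<in>U. \<forall>i j.
     (\<Sum>k\<in>UNIV. X p $ k * partial k (\<lambda>q. G q $ i $ j) p
        + G p $ k $ j * partial i (\<lambda>q. X q $ k) p
        + G p $ i $ k * partial j (\<lambda>q. X q $ k) p) = 0)"

definition lower :: "(real^4 \<Rightarrow> real^4^4) \<Rightarrow> (real^4 \<Rightarrow> real^4) \<Rightarrow> real^4 \<Rightarrow> 4 \<Rightarrow> real" where
  "lower G X q a = (\<Sum>b\<in>UNIV. G q $ a $ b * X q $ b)"

definition hypersurface_orthogonal :: "(real^4 \<Rightarrow> real^4^4) \<Rightarrow> (real^4) set \<Rightarrow> (real^4 \<Rightarrow> real^4) \<Rightarrow> bool" where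
  "hypersurface_orthogonal G U X \<longleftrightarrow> (\<forall>p\<in>U. \<forall>a b c.
     let Xl = lower G X; d = (\<lambda>i j. partial i (\<lambda>q. Xl q j) p) in
     Xl p a * (d b c - d c b) + Xl p b * (d c a - d a c) + Xl p c * (d a b - d b a) = 0)"

text \<open>Vector field K^0 d_0 + K^1 d_1 (orthogonal to the SO(3) orbits and depending
  only on x^0, x^1, i.e. commuting with SO(3)).\<close>
definition vf2 :: "(real \<times> real \<Rightarrow> real) \<Rightarrow> (real \<times> real \<Rightarrow> real) \<Rightarrow> real^4 \<Rightarrow> real^4" where
  "vf2 K0 K1 p = vector [K0 (p$1, p$2), K1 (p$1, p$2), 0, 0]"

text \<open>SO(3)-invariance in adapted coordinates: membership depends only on (x^0,x^1).\<close>
definition so3_invariant :: "(real^4) set \<Rightarrow> (real^4) set \<Rightarrow> bool" where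
  "so3_invariant U S \<longleftrightarrow> S \<subseteq> U \<and>
     (\<forall>p\<in>U. \<forall>q\<in>U. p$1 = q$1 \<and> p$2 = q$2 \<longrightarrow> (p \<in> S \<longleftrightarrow> q \<in> S))"

definition flow_invariant :: "(real^4 \<Rightarrow> real^4) \<Rightarrow> (real^4) set \<Rightarrow> (real^4) set \<Rightarrow> bool" where
  "flow_invariant X U S \<longleftrightarrow>
     (\<forall>\<sigma> J. is_interval J \<and> 0 \<in> J \<and>
        (\<forall>t\<in>J. \<sigma> t \<in> U \<and> (\<sigma> has_vector_derivative X (\<sigma> t)) (at t within J)) \<and>
        \<sigma> 0 \<in> S \<longrightarrow> (\<forall>t\<in>J. \<sigma> t \<in> S))"

definition eps2 :: "(real^4 \<Rightarrow> real^4^4) \<Rightarrow> real^4 \<Rightarrow> 4 \<Rightarrow> 4 \<Rightarrow> real" where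
  "eps2 G p a b =
     (let \<Delta> = G p $ 1 $ 1 * G p $ 2 $ 2 - (G p $ 1 $ 2)\<^sup>2 in
      if a = 1 \<and> b = 2 then 1 / sqrt (-\<Delta>)
      else if a = 2 \<and> b = 1 then - (1 / sqrt (-\<Delta>)) else 0)"

definition hess :: "(real^4 \<Rightarrow> real^4^4) \<Rightarrow> (real^4 \<Rightarrow> real) \<Rightarrow> real^4 \<Rightarrow> 4 \<Rightarrow> 4 \<Rightarrow> real" where
  "hess G f p a c = partial a (\<lambda>q. partial c f q) p
     - (\<Sum>k\<in>UNIV. christoffel G p k a c * partial k f p)"

definition photon_condition ::
  "(real^4 \<Rightarrow> real^4^4) \<Rightarrow> (real^4 \<Rightarrow> real) \<Rightarrow> (real^4 \<Rightarrow> real) \<Rightarrow> real^4 \<Rightarrow> bool" where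
  "photon_condition G r gth p \<longleftrightarrow>
     2 * gth p * (\<Sum>a\<in>UNIV. \<Sum>b\<in>UNIV. \<Sum>c\<in>UNIV. \<Sum>d\<in>UNIV.
         eps2 G p a b * eps2 G p c d * hess G r p a c * partial b r p * partial d r p)
     + (\<Sum>a\<in>UNIV. \<Sum>b\<in>UNIV. ginv G p a b * partial a r p * partial b r p)
       * (\<Sum>c\<in>UNIV. \<Sum>d\<in>UNIV. ginv G p c d * partial d r p * partial c gth p) = 0"

definition gradient :: "(real^4 \<Rightarrow> real^4^4) \<Rightarrow> (real^4 \<Rightarrow> real) \<Rightarrow> real^4 \<Rightarrow> real^4" where
  "gradient G f p = (\<chi> a. \<Sum>b\<in>UNIV. ginv G p a b * partial b f p)"

end

theory Submission
  imports Defs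
begin

text \<open>
  Since \<^term>\<open>r\<close> is invariant under the static flow and \<open>dr \<noteq> 0\<close>, near a point of the
  hypersurface \<open>S\<close> the level sets of \<^term>\<open>r\<close> are orbits of the flow. An invariant \<open>S\<close> is a
  union of such level sets, so if \<^term>\<open>r\<close> were not locally constant along \<open>S\<close>, then \<open>S\<close>
  would contain an open set; but it is the smooth image of a 3-dimensional set, hence null.
  Thus \<open>T S = ker dr\<close>.

  The Kodama vector \<open>T\<^sup>a = \<epsilon>\<^sup>a\<^sup>b r\<^sub>;\<^sub>b\<close> spans the static direction of \<open>T S\<close> and satisfies
  \<open>g(T,T) = -|\<nabla>r|\<^sup>2\<close>. For an angular vector \<open>w\<close> making \<open>k = T + w\<close> null, the photon condition
  is exactly \<open>2 g\<^sub>\<theta>\<^sub>\<theta> Hess r (k,k) = 0\<close>. If a null geodesic with velocity \<open>k\<close> stays in \<open>S\<close>,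
  then \<^term>\<open>r\<close> is constant along it and \<open>Hess r (k,k) = 0\<close>.

  Conversely, move along an orbit of the flow with constant parameter speed and along a great
  circle of the sphere. The covariant acceleration \<open>W\<close> of this curve has no angular part, it
  satisfies \<open>dr(W) = 0\<close> because \<open>Hess r (k,k) = 0\<close>, and it is orthogonal to the Killing field \<open>K\<close>
  because \<open>g(K,k)\<close> is a constant multiple of \<open>g(K,K)\<close>, which is constant along the orbits. As \<open>K\<close>
  is timelike on \<open>S\<close>, \<open>W = 0\<close>.
\<close>

subsection \<open>Flow boxes of planar vector fields with a first integral\<close>

definition integral_curve ::
  "('a::real_normed_vector \<Rightarrow> 'a) \<Rightarrow> 'a set \<Rightarrow> real set \<Rightarrow> (real \<Rightarrow> 'a) \<Rightarrow> bool" where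
  "integral_curve X B J \<sigma> \<longleftrightarrow> open J \<and> is_interval J \<and> 0 \<in> J \<and>
     (\<forall>t\<in>J. \<sigma> t \<in> B \<and> (\<sigma> has_vector_derivative X (\<sigma> t)) (at t))"

definition level_flow_box ::
  "('a::real_normed_vector \<Rightarrow> 'a) \<Rightarrow> ('a \<Rightarrow> real) \<Rightarrow> 'a set \<Rightarrow> bool" where
  "level_flow_box X r B \<longleftrightarrow> open B \<and>
     (\<forall>y\<in>B. \<exists>J \<sigma>. integral_curve X B J \<sigma> \<and> \<sigma> 0 = y \<and> {z \<in> B. r z = r y} \<subseteq> \<sigma> ` J)"

lemma integral_curve_mono: "integral_curve X B J \<sigma> \<Longrightarrow> B \<subseteq> B' \<Longrightarrow> integral_curve X B' J \<sigma>"
  unfolding integral_curve_def by blast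

lemma level_flow_boxE:
  assumes "level_flow_box X r B" "y \<in> B" "z \<in> B" "r z = r y"
  obtains J \<sigma> t where "integral_curve X B J \<sigma>" "\<sigma> 0 = y" "t \<in> J" "\<sigma> t = z"
proof -
  obtain J \<sigma> where "integral_curve X B J \<sigma>" "\<sigma> 0 = y" "{z \<in> B. r z = r y} \<subseteq> \<sigma> ` J"
    using assms(1,2) unfolding level_flow_box_def by meson
  moreover have "z \<in> {z \<in> B. r z = r y}" using assms(3,4) by simp
  ultimately show ?thesis using that by blast
qed

lemma linear_functional_kernel_plane:
  fixes f :: "'a::euclidean_space \<Rightarrow> real"
  assumes dim: "DIM('a) = 2" and f: "linear f" "f \<noteq> (\<lambda>_. 0)"
    and e: "f e = 0" "e \<noteq> 0" and v: "f v = 0"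
  obtains \<mu> where "v = \<mu> *\<^sub>R e"
proof -
  define a where "a = adjoint f 1"
  have f_eq: "f x = a \<bullet> x" for x
    using adjoint_works[OF f(1), of x 1] by (simp add: a_def inner_commute)
  then have "a \<noteq> 0" using f(2) by auto
  then have "dim {x. a \<bullet> x = 0} = 1" using dim by (simp add: dim_hyperplane)
  moreover have "span {e} \<subseteq> {x. a \<bullet> x = 0}" using e(1) by (auto simp: span_singleton f_eq)
  ultimately have "span {e} = {x. a \<bullet> x = 0}"
    using e(2) by (intro subspace_dim_equal) (auto simp: subspace_hyperplane)
  then show ?thesis using v that by (auto simp: f_eq span_singleton)
qed

lemma inverse_function_theorem_injective:
  fixes f :: "'a::euclidean_space \<Rightarrow> 'a"
  assumes "open U" "x0 \<in> U"
    and f': "\<And>x. x \<in> U \<Longrightarrow> (f has_derivative f' x) (at x)"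
    and f'_cont: "\<And>v. continuous_on U (\<lambda>x. f' x v)"
    and inj: "inj (f' x0)"
  obtains U' V g where "open U'" "U' \<subseteq> U" "x0 \<in> U'" "open V" "f x0 \<in> V" "homeomorphism U' V f g"
    "\<And>y. y \<in> V \<Longrightarrow> (g has_derivative inv (f' (g y))) (at y)"
    "\<And>y. y \<in> V \<Longrightarrow> bij (f' (g y))"
proof -
  have Blin: "blinfun_apply (Blinfun (f' x)) = f' x" if "x \<in> U" for x
    using f'[OF that] by (simp add: bounded_linear_Blinfun_apply has_derivative_bounded_linear)
  have "linear (f' x0)" using f' assms(2) has_derivative_linear by blast
  then obtain h where h: "linear h" "h \<circ> f' x0 = id"
    using inj linear_injective_left_inverse by blast
  have "continuous_on U (\<lambda>x. blinfun_apply (Blinfun (f' x)) i)" for i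
    using f'_cont[of i] by (rule continuous_on_eq) (simp add: Blin)
  then have "continuous_on U (\<lambda>x. Blinfun (f' x))"
    by (intro continuous_on_blinfun_componentwise)
  moreover have "Blinfun h o\<^sub>L Blinfun (f' x0) = id_blinfun"
    using h assms(2) by (intro blinfun_eqI)
      (simp add: Blin bounded_linear_Blinfun_apply linear_conv_bounded_linear pointfree_idE)
  ultimately obtain U' V g g' where
    "open U'" "U' \<subseteq> U" "x0 \<in> U'" "open V" "f x0 \<in> V" and hom: "homeomorphism U' V f g"
    and g': "\<And>y. y \<in> V \<Longrightarrow> (g has_derivative g' y) (at y)"
      "\<And>y. y \<in> V \<Longrightarrow> g' y = inv (blinfun_apply (Blinfun (f' (g y))))"
      "\<And>y. y \<in> V \<Longrightarrow> bij (blinfun_apply (Blinfun (f' (g y))))"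
    using inverse_function_theorem[OF assms(1) _ _ assms(2), of f "\<lambda>x. Blinfun (f' x)" "Blinfun h"]
      f' Blin by metis
  moreover have "g y \<in> U" if "y \<in> V" for y
    using hom \<open>U' \<subseteq> U\<close> that by (auto simp: homeomorphism_def)
  ultimately show ?thesis using that by (metis Blin)
qed

lemma DERIV_pos_inverse_on_interval:
  fixes f f' :: "real \<Rightarrow> real" and I :: "real set"
  assumes I: "open I" "is_interval I"
    and f': "\<And>x. x \<in> I \<Longrightarrow> (f has_real_derivative f' x) (at x)" "\<And>x. x \<in> I \<Longrightarrow> f' x > 0"
  obtains g where "open (f ` I)" "is_interval (f ` I)" "\<And>x. x \<in> I \<Longrightarrow> g (f x) = x"
    "\<And>x. x \<in> I \<Longrightarrow> (g has_real_derivative inverse (f' x)) (at (f x))"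
proof -
  have less: "f x < f y" if "x \<in> I" "y \<in> I" "x < y" for x y
  proof (rule DERIV_pos_imp_increasing[OF that(3)])
    fix z assume "x \<le> z" "z \<le> y"
    then have "z \<in> I" using mem_is_interval_1_I[OF I(2)] that by blast
    then show "\<exists>d. (f has_real_derivative d) (at z) \<and> 0 < d" using f' by blast
  qed
  have inj: "inj_on f I" by (rule linorder_inj_onI) (use less in force)+
  have cont: "continuous_on I f"
    using f'(1) DERIV_isCont continuous_at_imp_continuous_on by blast
  define g where "g = inv_into I f"
  have g_f: "g (f x) = x" if "x \<in> I" for x using inj that by (simp add: g_def)
  have "(g has_real_derivative inverse (f' x)) (at (f x))" if "x \<in> I" for x
    unfolding has_field_derivative_def
  proof (rule has_derivative_inverse_strong[OF I(1) that cont g_f])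
    show "(f has_derivative (*) (f' x)) (at x)"
      using f'(1)[OF that] by (simp add: has_field_derivative_def)
    show "(*) (f' x) \<circ> (*) (inverse (f' x)) = id" using f'(2)[OF that] by (auto simp: fun_eq_iff)
  qed
  moreover have "open (f ` I)" using invariance_of_domain[OF cont I(1) inj] .
  moreover have "is_interval (f ` I)"
    using connected_continuous_image[OF cont] I(2) by (simp add: is_interval_connected_1)
  ultimately show ?thesis using that g_f by blast
qed

lemma antiderivative_on_open_interval:
  fixes f :: "real \<Rightarrow> real"
  assumes f: "continuous_on {a<..<b} f" and c: "c \<in> {a<..<b}"
  obtains F where "F c = C" "\<And>t. t \<in> {a<..<b} \<Longrightarrow> (F has_real_derivative f t) (at t)"
proof -
  have "ereal a < ereal b" using c by auto
  moreover have "isCont f t" if "ereal a < ereal t" "ereal t < ereal b" for t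
    using f that by (simp add: continuous_on_eq_continuous_at)
  ultimately obtain F0 where "\<And>t. t \<in> {a<..<b} \<Longrightarrow> (F0 has_real_derivative f t) (at t)"
    using einterval_antiderivative[of "ereal a" "ereal b" f]
    by (auto simp: has_real_derivative_iff_has_vector_derivative)
  then have "((\<lambda>t. F0 t - F0 c + C) has_real_derivative f t) (at t)" if "t \<in> {a<..<b}" for t
    using that by (auto intro!: derivative_eq_intros)
  then show ?thesis using that[of "\<lambda>t. F0 t - F0 c + C"] by simp
qed

lemma integral_curve_reparametrization:
  fixes \<eta> :: "real \<Rightarrow> 'a::real_normed_vector" and h :: "real \<Rightarrow> real"
  assumes \<eta>: "\<And>s. s \<in> {a<..<b} \<Longrightarrow> \<eta> s \<in> B"
      "\<And>s. s \<in> {a<..<b} \<Longrightarrow> (\<eta> has_vector_derivative h s *\<^sub>R X (\<eta> s)) (at s)"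
    and h: "continuous_on {a<..<b} h" "\<And>s. s \<in> {a<..<b} \<Longrightarrow> h s > 0"
    and s0: "s0 \<in> {a<..<b}"
  obtains J \<sigma> where "integral_curve X B J \<sigma>" "\<sigma> 0 = \<eta> s0" "\<sigma> ` J = \<eta> ` {a<..<b}"
proof -
  let ?I = "{a<..<b}"
  obtain H where "H s0 = 0" and H: "\<And>s. s \<in> ?I \<Longrightarrow> (H has_real_derivative h s) (at s)"
    using antiderivative_on_open_interval[OF h(1) s0] by metis
  then obtain T where J: "open (H ` ?I)" "is_interval (H ` ?I)"
    and T_H: "\<And>s. s \<in> ?I \<Longrightarrow> T (H s) = s"
    and T': "\<And>s. s \<in> ?I \<Longrightarrow> (T has_real_derivative inverse (h s)) (at (H s))"
    using DERIV_pos_inverse_on_interval[of ?I H h] H h(2) by (auto simp: is_interval_1)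
  have "(\<eta> \<circ> T has_vector_derivative X (\<eta> s)) (at (H s))" if s: "s \<in> ?I" for s
  proof -
    have "(\<eta> \<circ> T has_vector_derivative inverse (h s) *\<^sub>R (h s *\<^sub>R X (\<eta> s))) (at (H s))"
      using T'[OF s] \<eta>(2)[OF s] T_H[OF s]
      by (intro vector_diff_chain_at) (simp_all add: has_real_derivative_iff_has_vector_derivative)
    then show ?thesis using h(2)[OF s] by simp
  qed
  then have "integral_curve X B (H ` ?I) (\<eta> \<circ> T)"
    using J \<eta>(1) T_H s0 \<open>H s0 = 0\<close> by (force simp: integral_curve_def)
  moreover have "(\<eta> \<circ> T) 0 = \<eta> s0" using T_H[OF s0] \<open>H s0 = 0\<close> by simp
  moreover have "(\<eta> \<circ> T) ` H ` ?I = \<eta> ` ?I" using T_H by (force simp: image_image)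
  ultimately show ?thesis using that by blast
qed

lemma inj_inner_Pair_functional:
  fixes f :: "'a::euclidean_space \<Rightarrow> real"
  assumes "DIM('a) = 2" "linear f" "f \<noteq> (\<lambda>_. 0)" "f e = 0" "e \<noteq> 0"
  shows "inj (\<lambda>v. (e \<bullet> v, f v))"
proof (rule linear_injective_0[THEN iffD2])
  show "linear (\<lambda>v. (e \<bullet> v, f v))"
    using assms(2) by (intro linearI) (auto simp: linear_add linear_cmul inner_add_right)
  show "\<forall>v. (e \<bullet> v, f v) = 0 \<longrightarrow> v = 0"
  proof (intro allI impI)
    fix v assume "(e \<bullet> v, f v) = 0"
    then have v: "e \<bullet> v = 0" "f v = 0" by (auto simp: zero_prod_def)
    obtain \<mu> where "v = \<mu> *\<^sub>R e"
      using linear_functional_kernel_plane[OF assms v(2)] by auto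
    then show "v = 0" using v(1) by auto
  qed
qed

lemma homeomorphism_onto_box:
  fixes F :: "'a::topological_space \<Rightarrow> real \<times> 'b::topological_space"
  assumes hom: "homeomorphism U V F g" and "open U" "open V" "x0 \<in> U"
  obtains B a b C where "open B" "x0 \<in> B" "B \<subseteq> U" "{a<..<b} \<times> C \<subseteq> V"
    "homeomorphism B ({a<..<b} \<times> C) F g"
proof -
  have "F x0 \<in> V" using hom \<open>x0 \<in> U\<close> by (auto simp: homeomorphism_def)
  then obtain A C where rect: "open A" "open C" "F x0 \<in> A \<times> C" "A \<times> C \<subseteq> V"
    using open_prod_elim[OF \<open>open V\<close>] by blast
  then obtain \<delta> where \<delta>: "\<delta> > 0" "ball (fst (F x0)) \<delta> \<subseteq> A"
    using open_contains_ball by (metis mem_Times_iff)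
  define I where "I = {fst (F x0) - \<delta><..<fst (F x0) + \<delta>}"
  have box: "I \<times> C \<subseteq> V"
    using rect(4) \<delta>(2) by (auto simp: I_def ball_eq_greaterThanLessThan)
  define B where "B = U \<inter> F -` (I \<times> C)"
  have "F ` B = F ` U \<inter> (I \<times> C)" unfolding B_def by blast
  then have "F ` B = I \<times> C"
    using box hom by (auto simp: homeomorphism_def)
  then have "homeomorphism B (I \<times> C) F g"
    using box by (intro homeomorphism_of_subsets[OF hom]) (auto simp: B_def)
  moreover have "open B"
    unfolding B_def using hom \<open>open U\<close> rect(2)
    by (intro continuous_open_preimage) (auto simp: open_Times I_def homeomorphism_def)
  moreover have "x0 \<in> B" "B \<subseteq> U"
    using \<open>x0 \<in> U\<close> rect(3) \<delta>(1) by (auto simp: B_def I_def mem_Times_iff)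
  ultimately show ?thesis using that box unfolding I_def by blast
qed

lemma has_vector_derivative_inverse_slice:
  fixes f' :: "'a::real_normed_vector \<Rightarrow> real \<times> 'b::real_normed_vector"
  assumes "(g has_derivative inv f') (at (s, c))" "bij f'" "f' v = (1, 0)"
  shows "((\<lambda>s. g (s, c)) has_vector_derivative v) (at s)"
proof -
  have "((\<lambda>s. (s, c)) has_vector_derivative (1, 0)) (at s)"
    by (auto intro!: derivative_eq_intros)
  moreover have "inv f' (1, 0) = v" using assms(2,3) by (metis bij_is_inj inv_f_f)
  ultimately show ?thesis
    using vector_derivative_diff_chain_within[of "\<lambda>s. (s, c)" "(1, 0)" s UNIV g "inv f'"] assms(1)
    by (simp add: o_def has_derivative_at_withinI)
qed

lemma first_integral_chart:
  fixes r :: "real \<times> real \<Rightarrow> real" and X :: "real \<times> real \<Rightarrow> real \<times> real"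
  assumes D: "open D" "x0 \<in> D"
    and r: "\<And>x. x \<in> D \<Longrightarrow> (r has_derivative r' x) (at x)" "\<And>v. continuous_on D (\<lambda>x. r' x v)"
    and X: "continuous_on D X" "X x0 \<noteq> 0"
    and r'X: "\<And>x. x \<in> D \<Longrightarrow> r' x (X x) = 0" and r'0: "r' x0 \<noteq> (\<lambda>_. 0)"
  obtains B a b C g where "open B" "x0 \<in> B" "B \<subseteq> D"
    "homeomorphism B ({a<..<b} \<times> C) (\<lambda>x. (X x0 \<bullet> x, r x)) g"
    "\<And>x. x \<in> B \<Longrightarrow> X x0 \<bullet> X x > 0"
    "\<And>s c. s \<in> {a<..<b} \<Longrightarrow> c \<in> C \<Longrightarrow>
       ((\<lambda>s. g (s, c)) has_vector_derivative X (g (s, c)) /\<^sub>R (X x0 \<bullet> X (g (s, c)))) (at s)"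
proof -
  define e where "e = X x0"
  define F where "F x = (e \<bullet> x, r x)" for x
  define F' where "F' x v = (e \<bullet> v, r' x v)" for x v
  define D' where "D' = D \<inter> (\<lambda>x. e \<bullet> X x) -` {0<..}"
  have lin: "linear (r' x)" if "x \<in> D" for x using r(1)[OF that] has_derivative_linear by blast
  have D': "open D'" "x0 \<in> D'"
    unfolding D'_def using D X(2)
    by (auto simp: e_def intro!: continuous_open_preimage continuous_intros X(1))
  have "inj (F' x0)"
    unfolding F'_def e_def using inj_inner_Pair_functional[OF _ lin r'0 r'X X(2)] D(2) by simp
  moreover have "(F has_derivative F' x) (at x)" if "x \<in> D'" for x
    unfolding F_def F'_def using r(1)[of x] that by (auto simp: D'_def intro!: derivative_eq_intros)
  moreover have "continuous_on D' (\<lambda>x. F' x v)" for v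
    unfolding F'_def D'_def by (intro continuous_intros continuous_on_subset[OF r(2)]) auto
  ultimately obtain U V g where U: "open U" "U \<subseteq> D'" "x0 \<in> U" and V: "open V" "F x0 \<in> V"
    and hom: "homeomorphism U V F g"
    and g': "\<And>y. y \<in> V \<Longrightarrow> (g has_derivative inv (F' (g y))) (at y)"
      "\<And>y. y \<in> V \<Longrightarrow> bij (F' (g y))"
    using inverse_function_theorem_injective[OF D', of F F'] by blast
  obtain B a b C where B: "open B" "x0 \<in> B" "B \<subseteq> U" and C: "{a<..<b} \<times> C \<subseteq> V"
    and homB: "homeomorphism B ({a<..<b} \<times> C) F g"
    using homeomorphism_onto_box[OF hom U(1) V(1) U(3)] by blast
  have "((\<lambda>s. g (s, c)) has_vector_derivative X (g (s, c)) /\<^sub>R (e \<bullet> X (g (s, c)))) (at s)"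
    if "s \<in> {a<..<b}" "c \<in> C" for s c
  proof -
    have V: "(s, c) \<in> V" using C that by blast
    define x where "x = g (s, c)"
    have x: "x \<in> D" "e \<bullet> X x > 0" using hom V U(2) by (auto simp: x_def homeomorphism_def D'_def)
    then have "F' x (X x /\<^sub>R (e \<bullet> X x)) = (1, 0)"
      using r'X lin by (simp add: F'_def linear_cmul)
    then show ?thesis
      using has_vector_derivative_inverse_slice[OF g'[OF V]] by (simp add: x_def)
  qed
  then show ?thesis
    using that[OF B(1,2) _ homB[unfolded F_def e_def]] B(3) U(2)
    by (force simp: D'_def e_def)
qed

lemma first_integral_level_flow_box:
  fixes r :: "real \<times> real \<Rightarrow> real" and X :: "real \<times> real \<Rightarrow> real \<times> real"
  assumes "open D" "x0 \<in> D"
    and "\<And>x. x \<in> D \<Longrightarrow> (r has_derivative r' x) (at x)" "\<And>v. continuous_on D (\<lambda>x. r' x v)"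
    and X_cont: "continuous_on D X" and "X x0 \<noteq> 0"
    and "\<And>x. x \<in> D \<Longrightarrow> r' x (X x) = 0" and "r' x0 \<noteq> (\<lambda>_. 0)"
  obtains B where "x0 \<in> B" "B \<subseteq> D" "level_flow_box X r B"
proof -
  obtain B a b C g where B: "open B" "x0 \<in> B" "B \<subseteq> D"
    and hom: "homeomorphism B ({a<..<b} \<times> C) (\<lambda>x. (X x0 \<bullet> x, r x)) g"
    and pos: "\<And>x. x \<in> B \<Longrightarrow> X x0 \<bullet> X x > 0"
    and g': "\<And>s c. s \<in> {a<..<b} \<Longrightarrow> c \<in> C \<Longrightarrow>
      ((\<lambda>s. g (s, c)) has_vector_derivative X (g (s, c)) /\<^sub>R (X x0 \<bullet> X (g (s, c)))) (at s)"
    using first_integral_chart[OF assms] by blast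
  have "\<exists>J \<sigma>. integral_curve X B J \<sigma> \<and> \<sigma> 0 = y \<and> {z \<in> B. r z = r y} \<subseteq> \<sigma> ` J"
    if y: "y \<in> B" for y
  proof -
    define \<eta> where "\<eta> s = g (s, r y)" for s
    have I: "X x0 \<bullet> z \<in> {a<..<b}" "r z \<in> C" if "z \<in> B" for z
      using hom that by (auto simp: homeomorphism_def)
    have \<eta>B: "\<eta> s \<in> B" if "s \<in> {a<..<b}" for s
      using hom that I(2)[OF y] by (auto simp: \<eta>_def homeomorphism_def)
    have \<eta>': "(\<eta> has_vector_derivative inverse (X x0 \<bullet> X (\<eta> s)) *\<^sub>R X (\<eta> s)) (at s)"
      if "s \<in> {a<..<b}" for s
      using g'[OF that I(2)[OF y]] by (simp add: \<eta>_def[abs_def])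
    have "continuous_on {a<..<b} \<eta>"
      using \<eta>' by (meson continuous_at_imp_continuous_on has_vector_derivative_continuous)
    then have "continuous_on {a<..<b} (\<lambda>s. X (\<eta> s))"
      by (rule continuous_on_compose2[OF X_cont]) (use \<eta>B B(3) in blast)
    then have "continuous_on {a<..<b} (\<lambda>s. inverse (X x0 \<bullet> X (\<eta> s)))"
      using pos[OF \<eta>B] by (intro continuous_intros) force+
    then obtain J \<sigma> where \<sigma>: "integral_curve X B J \<sigma>" "\<sigma> 0 = \<eta> (X x0 \<bullet> y)" "\<sigma> ` J = \<eta> ` {a<..<b}"
      using integral_curve_reparametrization[OF \<eta>B \<eta>' _ _ I(1)[OF y]] pos[OF \<eta>B] by auto
    have \<eta>_inner: "\<eta> (X x0 \<bullet> z) = z" if "z \<in> B" "r z = r y" for z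
      using homeomorphism_apply1[OF hom, of z] that by (simp add: \<eta>_def)
    then have "{z \<in> B. r z = r y} \<subseteq> \<sigma> ` J"
      using I(1) by (auto intro!: image_eqI[OF sym] simp: \<sigma>(3))
    then show ?thesis using \<sigma>(1,2) \<eta>_inner[OF y refl] by metis
  qed
  then have "level_flow_box X r B" using B(1) by (simp add: level_flow_box_def)
  with B(2,3) show ?thesis by (rule that)
qed

subsection \<open>Geodesics of the round sphere\<close>

definition sphere_geodesic_on ::
  "real set \<Rightarrow> (real \<Rightarrow> real) \<Rightarrow> (real \<Rightarrow> real) \<Rightarrow> (real \<Rightarrow> real) \<Rightarrow> (real \<Rightarrow> real) \<Rightarrow> bool" where
  "sphere_geodesic_on I \<theta> \<phi> \<theta>' \<phi>' \<longleftrightarrow> (\<forall>t\<in>I. 0 < \<theta> t \<and> \<theta> t < pi \<and>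
     (\<theta> has_real_derivative \<theta>' t) (at t) \<and> (\<phi> has_real_derivative \<phi>' t) (at t) \<and>
     (\<theta>' has_real_derivative sin (\<theta> t) * cos (\<theta> t) * (\<phi>' t)\<^sup>2) (at t) \<and>
     (\<phi>' has_real_derivative - 2 * cos (\<theta> t) / sin (\<theta> t) * \<theta>' t * \<phi>' t) (at t))"

lemma sphere_geodesic_on_subset:
  "sphere_geodesic_on I \<theta> \<phi> \<theta>' \<phi>' \<Longrightarrow> I' \<subseteq> I \<Longrightarrow> sphere_geodesic_on I' \<theta> \<phi> \<theta>' \<phi>'"
  by (auto simp: sphere_geodesic_on_def)

lemma sphere_geodesic_DERIV_speed:
  assumes "sphere_geodesic_on I \<theta> \<phi> \<theta>' \<phi>'" "t \<in> I"
  shows "((\<lambda>t. (\<theta>' t)\<^sup>2 + (sin (\<theta> t))\<^sup>2 * (\<phi>' t)\<^sup>2) has_real_derivative 0) (at t)"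
proof -
  have "sin (\<theta> t) \<noteq> 0"
    using assms sin_gt_zero[of "\<theta> t"] by (force simp: sphere_geodesic_on_def)
  then show ?thesis
    using assms unfolding sphere_geodesic_on_def
    by (auto intro!: derivative_eq_intros simp: field_simps power2_eq_square)
qed

lemma harmonic_oscillator_energy:
  fixes z z' :: "real \<Rightarrow> real"
  assumes "\<And>t. (z has_real_derivative z' t) (at t)"
    and "\<And>t. (z' has_real_derivative - \<omega>\<^sup>2 * z t) (at t)"
  shows "(z' t)\<^sup>2 + \<omega>\<^sup>2 * (z t)\<^sup>2 = (z' 0)\<^sup>2 + \<omega>\<^sup>2 * (z 0)\<^sup>2"
proof -
  have "((\<lambda>t. (z' t)\<^sup>2 + \<omega>\<^sup>2 * (z t)\<^sup>2) has_real_derivative 0) (at t)" for t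
    by (auto intro!: derivative_eq_intros assms simp: algebra_simps)
  then show ?thesis using DERIV_isconst_all[of "\<lambda>t. (z' t)\<^sup>2 + \<omega>\<^sup>2 * (z t)\<^sup>2" t 0] by simp
qed

text \<open>On a unit-sphere geodesic of speed \<open>\<omega>\<close> the height \<open>z = cos \<theta>\<close> oscillates harmonically, and
  \<open>L = sin\<^sup>2 \<theta> \<phi>'\<close> is the conserved angular momentum about the axis.\<close>

lemma sphere_geodesic_on_arccos:
  fixes z z' \<phi> :: "real \<Rightarrow> real" and \<omega> L :: real
  assumes abs_z: "\<And>t. t \<in> I \<Longrightarrow> \<bar>z t\<bar> < 1"
    and z': "\<And>t. t \<in> I \<Longrightarrow> (z has_real_derivative z' t) (at t)"
    and z'': "\<And>t. t \<in> I \<Longrightarrow> (z' has_real_derivative - \<omega>\<^sup>2 * z t) (at t)"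
    and energy: "\<And>t. t \<in> I \<Longrightarrow> (z' t)\<^sup>2 + L\<^sup>2 = \<omega>\<^sup>2 * (1 - (z t)\<^sup>2)"
    and \<phi>': "\<And>t. t \<in> I \<Longrightarrow> (\<phi> has_real_derivative L / (1 - (z t)\<^sup>2)) (at t)"
  shows "sphere_geodesic_on I (\<lambda>t. arccos (z t)) \<phi>
    (\<lambda>t. - z' t / sqrt (1 - (z t)\<^sup>2)) (\<lambda>t. L / (1 - (z t)\<^sup>2))"
  unfolding sphere_geodesic_on_def
proof (intro ballI conjI)
  fix t assume t: "t \<in> I"
  define w where "w t = sqrt (1 - (z t)\<^sup>2)" for t
  have w: "w t > 0" "(w t)\<^sup>2 = 1 - (z t)\<^sup>2"
    using abs_z[OF t] abs_square_less_1[of "z t"] by (auto simp: w_def)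
  have w': "(w has_real_derivative - z t * z' t / w t) (at t)"
    using w unfolding w_def by (auto intro!: derivative_eq_intros z'[OF t] simp: field_simps)
  have cos_sin: "cos (arccos (z t)) = z t" "sin (arccos (z t)) = w t"
    using abs_z[OF t] by (auto simp: w_def sin_arccos_abs)
  show "0 < arccos (z t)" "arccos (z t) < pi"
    using abs_z[OF t] arccos_lt_bounded[of "z t"] by auto
  show "((\<lambda>t. arccos (z t)) has_real_derivative - z' t / sqrt (1 - (z t)\<^sup>2)) (at t)"
    using abs_z[OF t] w(1) by (auto intro!: derivative_eq_intros z'[OF t] simp: w_def field_simps)
  show "(\<phi> has_real_derivative L / (1 - (z t)\<^sup>2)) (at t)" using \<phi>'[OF t] .
  have "((\<lambda>t. - z' t / w t) has_real_derivative z t * (\<omega>\<^sup>2 * (w t)\<^sup>2 - (z' t)\<^sup>2) / (w t)^3) (at t)"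
    using w(1) by (auto intro!: derivative_eq_intros w' z''[OF t]
        simp: field_simps power2_eq_square power3_eq_cube)
  moreover have "\<omega>\<^sup>2 * (w t)\<^sup>2 - (z' t)\<^sup>2 = L\<^sup>2" using energy[OF t] w(2) by simp
  moreover have "z t * L\<^sup>2 / (w t)^3 = w t * z t * (L / (w t)\<^sup>2)\<^sup>2"
    using w(1) by (simp add: field_simps power2_eq_square power3_eq_cube)
  ultimately have "((\<lambda>t. - z' t / w t) has_real_derivative w t * z t * (L / (w t)\<^sup>2)\<^sup>2) (at t)"
    by (simp only:)
  then show "((\<lambda>t. - z' t / sqrt (1 - (z t)\<^sup>2)) has_real_derivative
      sin (arccos (z t)) * cos (arccos (z t)) * (L / (1 - (z t)\<^sup>2))\<^sup>2) (at t)"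
    unfolding cos_sin w(2) by (simp add: w_def)
  have "1 - (z t)\<^sup>2 \<noteq> 0" using w(1) unfolding w(2)[symmetric] by simp
  then have "((\<lambda>t. L / (1 - (z t)\<^sup>2)) has_real_derivative
      2 * L * z t * z' t / (1 - (z t)\<^sup>2)\<^sup>2) (at t)"
    by (auto intro!: derivative_eq_intros z'[OF t] simp: power2_eq_square)
  moreover have "2 * L * z t * z' t / ((w t)\<^sup>2)\<^sup>2
      = - 2 * z t / w t * (- z' t / w t) * (L / (w t)\<^sup>2)"
    using w(1) by (simp add: field_simps power2_eq_square)
  ultimately show "((\<lambda>t. L / (1 - (z t)\<^sup>2)) has_real_derivative
      - 2 * cos (arccos (z t)) / sin (arccos (z t)) * (- z' t / sqrt (1 - (z t)\<^sup>2))
        * (L / (1 - (z t)\<^sup>2))) (at t)"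
    unfolding cos_sin w(2) by (simp add: w_def)
qed

lemma sphere_geodesic_exists:
  fixes \<theta>0 \<phi>0 u v :: real
  assumes \<theta>0: "0 < \<theta>0" "\<theta>0 < pi" and uv: "(u, v) \<noteq> (0, 0)"
  obtains \<epsilon> \<theta> \<phi> \<theta>' \<phi>' where "\<epsilon> > 0" "sphere_geodesic_on {-\<epsilon><..<\<epsilon>} \<theta> \<phi> \<theta>' \<phi>'"
    "\<theta> 0 = \<theta>0" "\<phi> 0 = \<phi>0" "\<theta>' 0 = u" "\<phi>' 0 = v"
proof -
  have sin_pos: "sin \<theta>0 > 0" using \<theta>0 sin_gt_zero by blast
  define \<omega> where "\<omega> = sqrt (u\<^sup>2 + (sin \<theta>0 * v)\<^sup>2)"
  have \<omega>: "\<omega>\<^sup>2 = u\<^sup>2 + (sin \<theta>0 * v)\<^sup>2" "\<omega> \<noteq> 0"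
    using uv sin_pos by (auto simp: \<omega>_def sum_power2_eq_zero_iff)
  define L where "L = (sin \<theta>0)\<^sup>2 * v"
  define z where "z t = cos \<theta>0 * cos (\<omega> * t) - sin \<theta>0 * u / \<omega> * sin (\<omega> * t)" for t
  define z' where "z' t = - cos \<theta>0 * \<omega> * sin (\<omega> * t) - sin \<theta>0 * u * cos (\<omega> * t)" for t
  have z': "(z has_real_derivative z' t) (at t)" for t
    unfolding z_def z'_def using \<omega>(2) by (auto intro!: derivative_eq_intros simp: field_simps)
  have z'': "(z' has_real_derivative - \<omega>\<^sup>2 * z t) (at t)" for t
    unfolding z_def z'_def using \<omega>(2)
    by (auto intro!: derivative_eq_intros simp: field_simps power2_eq_square)
  have init: "z 0 = cos \<theta>0" "z' 0 = - sin \<theta>0 * u" by (simp_all add: z_def z'_def)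
  have "(z' 0)\<^sup>2 + L\<^sup>2 = \<omega>\<^sup>2 * (1 - (z 0)\<^sup>2)"
    unfolding init \<omega>(1) L_def cos_squared_eq by (simp add: algebra_simps power2_eq_square)
  then have energy: "(z' t)\<^sup>2 + L\<^sup>2 = \<omega>\<^sup>2 * (1 - (z t)\<^sup>2)" for t
    using harmonic_oscillator_energy[OF z' z'', of t] by (simp add: algebra_simps)
  have "\<bar>z 0\<bar> < 1"
    using sin_pos by (simp add: init abs_square_less_1[symmetric] cos_squared_eq)
  moreover have z_cont: "continuous_on S z" for S
    using z' DERIV_isCont continuous_at_imp_continuous_on by blast
  then have "open {t. \<bar>z t\<bar> < 1}" by (intro open_Collect_less continuous_intros)
  ultimately obtain \<epsilon> where \<epsilon>: "\<epsilon> > 0" "ball 0 \<epsilon> \<subseteq> {t. \<bar>z t\<bar> < 1}"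
    using open_contains_ball by blast
  then have abs_z: "\<bar>z t\<bar> < 1" if "t \<in> {-\<epsilon><..<\<epsilon>}" for t
    using that by (auto simp: ball_eq_greaterThanLessThan)
  have "continuous_on {-\<epsilon><..<\<epsilon>} (\<lambda>t. L / (1 - (z t)\<^sup>2))"
    using abs_z by (intro continuous_intros z_cont) (force simp: abs_square_eq_1)
  then obtain \<phi> where "\<phi> 0 = \<phi>0"
    and \<phi>': "\<And>t. t \<in> {-\<epsilon><..<\<epsilon>} \<Longrightarrow> (\<phi> has_real_derivative L / (1 - (z t)\<^sup>2)) (at t)"
    using antiderivative_on_open_interval[of "-\<epsilon>" \<epsilon> _ 0] \<epsilon>(1) by auto
  from that[OF \<epsilon>(1) sphere_geodesic_on_arccos[OF abs_z z' z'' energy \<phi>']] show ?thesis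
    using \<theta>0 sin_pos \<open>\<phi> 0 = \<phi>0\<close> by (simp add: init arccos_cos L_def sin_squared_eq[symmetric])
qed

subsection \<open>Semi-Riemannian geometry in coordinates\<close>

definition differential :: "(real^4 \<Rightarrow> real) \<Rightarrow> real^4 \<Rightarrow> real^4 \<Rightarrow> real" where
  "differential f p v = (\<Sum>i\<in>UNIV. partial i f p * v $ i)"

definition second_differential :: "(real^4 \<Rightarrow> real) \<Rightarrow> real^4 \<Rightarrow> real^4 \<Rightarrow> real" where
  "second_differential f p v = (\<Sum>i\<in>UNIV. differential (partial i f) p v * v $ i)"

definition metric_derivative ::
  "(real^4 \<Rightarrow> real^4^4) \<Rightarrow> real^4 \<Rightarrow> real^4 \<Rightarrow> real^4 \<Rightarrow> real^4 \<Rightarrow> real" where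
  "metric_derivative G p u v w =
     (\<Sum>i\<in>UNIV. \<Sum>j\<in>UNIV. differential (\<lambda>q. G q $ i $ j) p u * v $ i * w $ j)"

definition covariant_acceleration ::
  "(real^4 \<Rightarrow> real^4^4) \<Rightarrow> real^4 \<Rightarrow> real^4 \<Rightarrow> real^4 \<Rightarrow> real^4" where
  "covariant_acceleration G p v a =
     (\<chi> m. a $ m + (\<Sum>i\<in>UNIV. \<Sum>j\<in>UNIV. christoffel G p m i j * v $ i * v $ j))"

definition hess_form :: "(real^4 \<Rightarrow> real^4^4) \<Rightarrow> (real^4 \<Rightarrow> real) \<Rightarrow> real^4 \<Rightarrow> real^4 \<Rightarrow> real" where
  "hess_form G f p v = (\<Sum>a\<in>UNIV. \<Sum>c\<in>UNIV. hess G f p a c * v $ a * v $ c)"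

definition vector_field_derivative ::
  "(real^4 \<Rightarrow> real^4) \<Rightarrow> real^4 \<Rightarrow> real^4 \<Rightarrow> real^4" where
  "vector_field_derivative X p v = (\<chi> k. differential (\<lambda>q. X q $ k) p v)"

lemma linear_differential: "linear (differential f p)"
  by (rule linearI) (simp_all add: differential_def algebra_simps sum.distrib sum_distrib_left)

lemma differential_axis: "differential f p (axis i 1) = partial i f p"
  by (simp add: differential_def axis_def if_distrib cong: if_cong)

lemma differential_eq_frechet_derivative:
  assumes "f differentiable (at p)"
  shows "differential f p = frechet_derivative f (at p)"
proof (rule linear_eq_stdbasis[OF linear_differential])
  show "linear (frechet_derivative f (at p))" using assms by (rule linear_frechet_derivative)
  show "differential f p b = frechet_derivative f (at p) b" if "b \<in> Basis" for b
    using that by (auto simp: Basis_vec_def differential_axis partial_def)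
qed

lemma has_derivative_differential:
  "f differentiable (at p) \<Longrightarrow> (f has_derivative differential f p) (at p)"
  using differential_eq_frechet_derivative frechet_derivative_works by metis

lemma differential_eqI: "(f has_derivative f') (at p) \<Longrightarrow> differential f p = f'"
  using has_derivative_differential has_derivative_unique differentiableI by blast

lemma differential_const [simp]: "differential (\<lambda>q. c) p = (\<lambda>v. 0)"
  by (rule differential_eqI) (rule has_derivative_const)

lemma partial_const [simp]: "partial i (\<lambda>q. c) p = 0"
  by (simp flip: differential_axis)

lemma DERIV_const_on_open:
  fixes f :: "real \<Rightarrow> real"
  assumes "(f has_real_derivative d) (at t)" "open J" "t \<in> J" "\<And>s. s \<in> J \<Longrightarrow> f s = c"
  shows "d = 0"
  using has_field_derivative_transform_within_open[OF assms] DERIV_unique DERIV_const by blast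

lemma has_real_derivative_compose_curve:
  fixes f :: "'a::real_normed_vector \<Rightarrow> real"
  assumes "(f has_derivative f') (at (\<gamma> t))" "(\<gamma> has_vector_derivative v) (at t)"
  shows "((\<lambda>s. f (\<gamma> s)) has_real_derivative f' v) (at t)"
proof -
  have "linear f'" using assms(1) has_derivative_linear by blast
  then show ?thesis
    using has_derivative_compose[OF assms(2)[unfolded has_vector_derivative_def] assms(1)]
    by (simp add: has_field_derivative_def linear_cmul[of f'] mult_commute_abs)
qed

lemmas has_real_derivative_differential =
  has_real_derivative_compose_curve[OF has_derivative_differential]

lemma has_vector_derivative_componentwise_vec:
  fixes f :: "real \<Rightarrow> real^'n"
  shows "(f has_vector_derivative v) (at t within S) \<longleftrightarrow>
    (\<forall>i. ((\<lambda>s. f s $ i) has_real_derivative v $ i) (at t within S))"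
  unfolding has_vector_derivative_def has_field_derivative_def
  by (subst has_derivative_componentwise_within)
    (auto simp: Basis_vec_def inner_axis mult.commute[of _ "v $ _"])

lemma sum_quadratic_form_combination:
  fixes A :: "'a \<Rightarrow> 'i \<Rightarrow> 'j \<Rightarrow> 'b::comm_semiring_0"
  shows "(\<Sum>i\<in>I. \<Sum>j\<in>J. (\<Sum>k\<in>M. A k i j * c k) * v i * w j)
    = (\<Sum>k\<in>M. c k * (\<Sum>i\<in>I. \<Sum>j\<in>J. A k i j * v i * w j))"
  unfolding sum_distrib_left sum_distrib_right
  by (subst (2) sum.swap, subst sum.swap) (simp add: ac_simps)

lemma gform_eq_inner: "gform G p v w = v \<bullet> (G p *v w)"
  by (simp add: gform_def inner_vec_def matrix_vector_mult_def sum_distrib_left algebra_simps)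

lemma linear_gform: "linear (gform G p v)"
  by (rule linearI) (simp_all add: gform_eq_inner inner_add_right matrix_vector_right_distrib
      matrix_vector_mult_scaleR)

lemma geodesic_iff_covariant_acceleration:
  "geodesic G U J \<gamma> \<longleftrightarrow> (\<exists>\<gamma>' \<gamma>''. \<forall>t\<in>J. \<gamma> t \<in> U \<and>
     (\<gamma> has_vector_derivative \<gamma>' t) (at t) \<and> (\<gamma>' has_vector_derivative \<gamma>'' t) (at t) \<and>
     covariant_acceleration G (\<gamma> t) (\<gamma>' t) (\<gamma>'' t) = 0)"
  by (simp add: geodesic_def covariant_acceleration_def vec_eq_iff)

lemma hess_form_eq_acceleration:
  "hess_form G f p v + differential f p (covariant_acceleration G p v a)
    = second_differential f p v + differential f p a"
proof -
  have "(\<Sum>a\<in>UNIV. \<Sum>c\<in>UNIV. (\<Sum>k\<in>UNIV. christoffel G p k a c * partial k f p) * v $ a * v $ c)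
      = (\<Sum>k\<in>UNIV. partial k f p * (\<Sum>a\<in>UNIV. \<Sum>c\<in>UNIV. christoffel G p k a c * v $ a * v $ c))"
    by (rule sum_quadratic_form_combination)
  moreover have "second_differential f p v
      = (\<Sum>a\<in>UNIV. \<Sum>c\<in>UNIV. partial a (partial c f) p * v $ a * v $ c)"
    unfolding second_differential_def differential_def sum_distrib_right by (rule sum.swap)
  ultimately show ?thesis
    by (simp add: hess_form_def hess_def covariant_acceleration_def differential_def
        left_diff_distrib sum_subtractf distrib_left sum.distrib)
qed

lemma DERIV_differential_along_curve:
  assumes \<gamma>: "(\<gamma> has_vector_derivative \<gamma>' t) (at t)" and \<gamma>': "(\<gamma>' has_vector_derivative a) (at t)"
    and f: "\<And>i. partial i f differentiable (at (\<gamma> t))"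
  shows "((\<lambda>s. differential f (\<gamma> s) (\<gamma>' s)) has_real_derivative
    hess_form G f (\<gamma> t) (\<gamma>' t)
      + differential f (\<gamma> t) (covariant_acceleration G (\<gamma> t) (\<gamma>' t) a)) (at t)"
proof -
  have "((\<lambda>s. \<gamma>' s $ i) has_real_derivative a $ i) (at t)" for i
    using \<gamma>' by (simp add: has_vector_derivative_componentwise_vec)
  then have "((\<lambda>s. differential f (\<gamma> s) (\<gamma>' s)) has_real_derivative
      (\<Sum>i\<in>UNIV. differential (partial i f) (\<gamma> t) (\<gamma>' t) * \<gamma>' t $ i
        + a $ i * partial i f (\<gamma> t))) (at t)"
    unfolding differential_def[of f]
    by (intro DERIV_sum DERIV_mult has_real_derivative_differential[OF f \<gamma>])
  then show ?thesis
    unfolding hess_form_eq_acceleration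
    by (simp add: second_differential_def differential_def[of f] sum.distrib mult.commute)
qed

definition christoffel_first_kind :: "(real^4 \<Rightarrow> real^4^4) \<Rightarrow> real^4 \<Rightarrow> 4 \<Rightarrow> 4 \<Rightarrow> 4 \<Rightarrow> real" where
  "christoffel_first_kind G p l i j =
     (partial i (\<lambda>q. G q $ j $ l) p + partial j (\<lambda>q. G q $ i $ l) p
       - partial l (\<lambda>q. G q $ i $ j) p) / 2"

lemma sum_christoffel_first_kind:
  "(\<Sum>i\<in>UNIV. \<Sum>j\<in>UNIV. (\<Sum>l\<in>UNIV. christoffel_first_kind G p l i j * u $ l) * v $ i * v $ j)
    = metric_derivative G p v v u - metric_derivative G p u v v / 2"
proof -
  have "(\<Sum>i\<in>UNIV. \<Sum>j\<in>UNIV. \<Sum>l\<in>UNIV. partial i (\<lambda>q. G q $ j $ l) p * u $ l * v $ i * v $ j)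
      = metric_derivative G p v v u"
    unfolding metric_derivative_def differential_def sum_distrib_right
    by (subst sum.swap, subst (2) sum.swap) (simp add: algebra_simps)
  moreover have "(\<Sum>i\<in>UNIV. \<Sum>j\<in>UNIV. \<Sum>l\<in>UNIV. partial j (\<lambda>q. G q $ i $ l) p * u $ l * v $ i * v $ j)
      = metric_derivative G p v v u"
    unfolding metric_derivative_def differential_def sum_distrib_right
    by (subst (2) sum.swap) (simp add: algebra_simps)
  moreover have "(\<Sum>i\<in>UNIV. \<Sum>j\<in>UNIV. \<Sum>l\<in>UNIV. partial l (\<lambda>q. G q $ i $ j) p * u $ l * v $ i * v $ j)
      = metric_derivative G p u v v"
    unfolding metric_derivative_def differential_def sum_distrib_right ..
  ultimately show ?thesis
    by (simp add: christoffel_first_kind_def sum_distrib_right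
        add_divide_distrib diff_divide_distrib
        sum.distrib sum_subtractf distrib_right left_diff_distrib flip: sum_divide_distrib)
qed

locale semi_riemannian_chart =
  fixes G :: "real^4 \<Rightarrow> real^4^4" and U :: "(real^4) set"
  assumes metric_symmetric: "G q $ i $ j = G q $ j $ i"
    and metric_nondegenerate: "p \<in> U \<Longrightarrow> invertible (G p)"
    and metric_differentiable: "p \<in> U \<Longrightarrow> (\<lambda>q. G q $ i $ j) differentiable (at p)"
begin

lemma gform_commute: "gform G p v w = gform G p w v"
  unfolding gform_def by (subst sum.swap) (simp add: metric_symmetric[of p] algebra_simps)

lemma metric_derivative_commute: "metric_derivative G p u v w = metric_derivative G p u w v"
  unfolding metric_derivative_def by (subst sum.swap)
    (simp add: metric_symmetric[of _ i j for i j] algebra_simps)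

lemma metric_mult_ginv:
  assumes "p \<in> U"
  shows "G p *v (\<chi> k. \<Sum>l\<in>UNIV. ginv G p k l * x l) = (\<chi> l. x l)"
proof -
  have "G p ** matrix_inv (G p) = mat 1"
    using metric_nondegenerate[OF assms] unfolding invertible_def matrix_inv_def
    by (rule someI2_ex) simp
  moreover have "(\<chi> k. \<Sum>l\<in>UNIV. ginv G p k l * x l) = matrix_inv (G p) *v (\<chi> l. x l)"
    by (simp add: vec_eq_iff ginv_def matrix_vector_mult_def)
  ultimately show ?thesis by (simp add: matrix_vector_mul_assoc)
qed

lemma gform_gradient:
  assumes "p \<in> U"
  shows "gform G p v (gradient G f p) = differential f p v"
  unfolding gform_eq_inner gradient_def metric_mult_ginv[OF assms]
  by (simp add: inner_vec_def differential_def mult.commute)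

lemma gform_covariant_acceleration:
  assumes "p \<in> U"
  shows "gform G p u (covariant_acceleration G p v a)
    = gform G p u a + metric_derivative G p v v u - metric_derivative G p u v v / 2"
proof -
  define c where "c = (\<chi> k. \<Sum>l\<in>UNIV. ginv G p k l *
      (\<Sum>i\<in>UNIV. \<Sum>j\<in>UNIV. christoffel_first_kind G p l i j * v $ i * v $ j))"
  have "christoffel G p k i j = (\<Sum>l\<in>UNIV. christoffel_first_kind G p l i j * ginv G p k l)"
    for k i j
    by (simp add: christoffel_def christoffel_first_kind_def sum_divide_distrib mult.commute)
  then have "covariant_acceleration G p v a = a + c"
    by (simp add: covariant_acceleration_def c_def vec_eq_iff sum_quadratic_form_combination)
  then have "gform G p u (covariant_acceleration G p v a) = gform G p u a + gform G p u c"
    by (simp add: linear_add[OF linear_gform])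
  also have "gform G p u c = (\<Sum>l\<in>UNIV. u $ l *
      (\<Sum>i\<in>UNIV. \<Sum>j\<in>UNIV. christoffel_first_kind G p l i j * v $ i * v $ j))"
    unfolding gform_eq_inner c_def metric_mult_ginv[OF assms] by (simp add: inner_vec_def)
  also have "\<dots> = (\<Sum>i\<in>UNIV. \<Sum>j\<in>UNIV.
      (\<Sum>l\<in>UNIV. christoffel_first_kind G p l i j * u $ l) * v $ i * v $ j)"
    by (rule sum_quadratic_form_combination[symmetric])
  also have "\<dots> = metric_derivative G p v v u - metric_derivative G p u v v / 2"
    by (rule sum_christoffel_first_kind)
  finally show ?thesis by simp
qed

lemma hess_form_eq_metric_derivative:
  fixes f :: "real^4 \<Rightarrow> real"
  assumes "p \<in> U"
  defines "n \<equiv> gradient G f p"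
  shows "hess_form G f p v
    = second_differential f p v - metric_derivative G p v v n + metric_derivative G p n v v / 2"
proof -
  have "differential f p (covariant_acceleration G p v 0)
      = gform G p n (covariant_acceleration G p v 0)"
    unfolding n_def gform_commute[of p "gradient G f p"] gform_gradient[OF assms(1)] ..
  moreover have "gform G p n 0 = 0" "differential f p 0 = 0"
    using linear_0[OF linear_gform] linear_0[OF linear_differential] by auto
  ultimately show ?thesis
    using hess_form_eq_acceleration[of G f p v 0]
      gform_covariant_acceleration[OF assms(1), of n v 0]
    by simp
qed

lemma gform_vector_field_derivative_killing:
  assumes "killing_field G U X" "p \<in> U"
  shows "gform G p (vector_field_derivative X p v) v = - metric_derivative G p (X p) v v / 2"
proof -
  let ?dX = "\<lambda>i k. partial i (\<lambda>q. X q $ k) p"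
  have "0 = (\<Sum>i\<in>UNIV. \<Sum>j\<in>UNIV. (\<Sum>k\<in>UNIV. X p $ k * partial k (\<lambda>q. G q $ i $ j) p
        + G p $ k $ j * ?dX i k + G p $ i $ k * ?dX j k) * v $ i * v $ j)"
    using assms unfolding killing_field_def by simp
  also have "\<dots> = metric_derivative G p (X p) v v
    + (\<Sum>i\<in>UNIV. \<Sum>j\<in>UNIV. (\<Sum>k\<in>UNIV. G p $ k $ j * ?dX i k) * v $ i * v $ j)
    + (\<Sum>i\<in>UNIV. \<Sum>j\<in>UNIV. (\<Sum>k\<in>UNIV. G p $ i $ k * ?dX j k) * v $ i * v $ j)"
    by (simp add: metric_derivative_def differential_def sum.distrib distrib_right
        mult.commute[of "X p $ _"])
  also have "(\<Sum>i\<in>UNIV. \<Sum>j\<in>UNIV. (\<Sum>k\<in>UNIV. G p $ k $ j * ?dX i k) * v $ i * v $ j)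
      = gform G p (vector_field_derivative X p v) v"
    unfolding gform_def vector_field_derivative_def differential_def vec_lambda_beta
      sum_distrib_left sum_distrib_right
    by (subst (2) sum.swap, subst sum.swap, subst (2) sum.swap) (simp add: algebra_simps)
  also have "(\<Sum>i\<in>UNIV. \<Sum>j\<in>UNIV. (\<Sum>k\<in>UNIV. G p $ i $ k * ?dX j k) * v $ i * v $ j)
      = gform G p v (vector_field_derivative X p v)"
    unfolding gform_def vector_field_derivative_def differential_def vec_lambda_beta
      sum_distrib_left sum_distrib_right
    by (subst (2) sum.swap) (simp add: algebra_simps)
  finally show ?thesis using gform_commute[of p v] by simp
qed

lemma has_real_derivative_gform:
  assumes "\<gamma> t \<in> U" "(\<gamma> has_vector_derivative \<gamma>') (at t)"
    and "(\<xi> has_vector_derivative \<xi>') (at t)" "(\<eta> has_vector_derivative \<eta>') (at t)"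
  shows "((\<lambda>s. gform G (\<gamma> s) (\<xi> s) (\<eta> s)) has_real_derivative
    metric_derivative G (\<gamma> t) \<gamma>' (\<xi> t) (\<eta> t) + gform G (\<gamma> t) \<xi>' (\<eta> t)
      + gform G (\<gamma> t) (\<xi> t) \<eta>') (at t)"
proof -
  have "((\<lambda>s. G (\<gamma> s) $ i $ j) has_real_derivative differential (\<lambda>q. G q $ i $ j) (\<gamma> t) \<gamma>') (at t)"
    for i j
    using has_real_derivative_differential[OF metric_differentiable[OF assms(1)] assms(2)] .
  moreover have "((\<lambda>s. \<xi> s $ i) has_real_derivative \<xi>' $ i) (at t)"
    "((\<lambda>s. \<eta> s $ i) has_real_derivative \<eta>' $ i) (at t)" for i
    using assms(3,4) by (simp_all add: has_vector_derivative_componentwise_vec)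
  ultimately have "((\<lambda>s. gform G (\<gamma> s) (\<xi> s) (\<eta> s)) has_real_derivative
    (\<Sum>i\<in>UNIV. \<Sum>j\<in>UNIV.
       (differential (\<lambda>q. G q $ i $ j) (\<gamma> t) \<gamma>' * \<xi> t $ i + \<xi>' $ i * G (\<gamma> t) $ i $ j) * \<eta> t $ j
       + \<eta>' $ j * (G (\<gamma> t) $ i $ j * \<xi> t $ i))) (at t)"
    unfolding gform_def by (intro DERIV_sum DERIV_mult)
  then show ?thesis
    by (simp add: gform_def metric_derivative_def sum.distrib algebra_simps)
qed

lemma has_vector_derivative_vector_field:
  assumes "(\<gamma> has_vector_derivative v) (at t)" "\<And>k. (\<lambda>q. X q $ k) differentiable (at (\<gamma> t))"
  shows "((\<lambda>s. X (\<gamma> s)) has_vector_derivative vector_field_derivative X (\<gamma> t) v) (at t)"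
  using has_real_derivative_differential[OF assms(2,1)]
  by (simp add: has_vector_derivative_componentwise_vec vector_field_derivative_def)

lemma DERIV_killing_momentum:
  assumes "killing_field G U X" "\<gamma> t \<in> U" "\<And>k. (\<lambda>q. X q $ k) differentiable (at (\<gamma> t))"
    and "(\<gamma> has_vector_derivative \<gamma>' t) (at t)" "(\<gamma>' has_vector_derivative a) (at t)"
  shows "((\<lambda>s. gform G (\<gamma> s) (X (\<gamma> s)) (\<gamma>' s)) has_real_derivative
    gform G (\<gamma> t) (X (\<gamma> t)) (covariant_acceleration G (\<gamma> t) (\<gamma>' t) a)) (at t)"
  using has_real_derivative_gform[OF assms(2,4) has_vector_derivative_vector_field[OF assms(4,3)]
      assms(5)]
  unfolding gform_vector_field_derivative_killing[OF assms(1,2)]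
    gform_covariant_acceleration[OF assms(2)] metric_derivative_commute[of "\<gamma> t" "\<gamma>' t" "X (\<gamma> t)"]
  by (simp add: algebra_simps)

lemma gform_differentiable:
  assumes "p \<in> U" "\<And>k. (\<lambda>q. X q $ k) differentiable (at p)"
  shows "(\<lambda>q. gform G q (X q) (X q)) differentiable (at p)"
  unfolding gform_def using metric_differentiable[OF assms(1)] assms(2)
  by (intro differentiable_sum differentiable_mult) simp_all

lemma differential_killing_norm:
  assumes "killing_field G U X" "p \<in> U" and X: "\<And>k. (\<lambda>q. X q $ k) differentiable (at p)"
  shows "differential (\<lambda>q. gform G q (X q) (X q)) p (X p) = 0"
proof -
  define \<gamma> where "\<gamma> s = p + s *\<^sub>R X p" for s
  have \<gamma>: "\<gamma> 0 = p" "(\<gamma> has_vector_derivative X p) (at 0)"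
    unfolding \<gamma>_def by (auto intro!: derivative_eq_intros)
  have dX: "((\<lambda>s. X (\<gamma> s)) has_vector_derivative vector_field_derivative X p (X p)) (at 0)"
    using has_vector_derivative_vector_field[OF \<gamma>(2), of X] X by (simp add: \<gamma>(1))
  have "((\<lambda>s. gform G (\<gamma> s) (X (\<gamma> s)) (X (\<gamma> s))) has_real_derivative
      metric_derivative G p (X p) (X p) (X p) + gform G p (vector_field_derivative X p (X p)) (X p)
        + gform G p (X p) (vector_field_derivative X p (X p))) (at 0)"
    using has_real_derivative_gform[of \<gamma> 0, OF _ \<gamma>(2) dX dX] assms(2) by (simp add: \<gamma>(1))
  moreover have "((\<lambda>s. gform G (\<gamma> s) (X (\<gamma> s)) (X (\<gamma> s))) has_real_derivative
      differential (\<lambda>q. gform G q (X q) (X q)) p (X p)) (at 0)"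
    using has_real_derivative_differential[of "\<lambda>q. gform G q (X q) (X q)" \<gamma> 0, OF _ \<gamma>(2)]
      gform_differentiable[OF assms(2) X] by (simp add: \<gamma>(1))
  ultimately have "differential (\<lambda>q. gform G q (X q) (X q)) p (X p)
      = metric_derivative G p (X p) (X p) (X p)
        + gform G p (vector_field_derivative X p (X p)) (X p)
        + gform G p (X p) (vector_field_derivative X p (X p))"
    by (rule DERIV_unique[rotated])
  then show ?thesis
    using gform_commute[of p "X p" "vector_field_derivative X p (X p)"]
      gform_vector_field_derivative_killing[OF assms(1,2), of "X p"] by linarith
qed

end

subsection \<open>Functions of the two non-angular coordinates\<close>

lemma smooth_fun_continuous_on: "smooth_fun D f \<Longrightarrow> continuous_on D f"
  unfolding smooth_fun_def by (metis Ck.simps(1))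

lemma smooth_fun_differentiable:
  assumes "smooth_fun D f" "open D" "x \<in> D"
  shows "f differentiable (at x)"
proof -
  have "Ck (Suc 0) D f" using assms(1) unfolding smooth_fun_def by blast
  then show ?thesis using assms(2,3) by (simp add: differentiable_on_eq_differentiable_at)
qed

lemma smooth_fun_frechet_derivative_Basis:
  assumes "smooth_fun D f" "b \<in> Basis"
  shows "smooth_fun D (\<lambda>x. frechet_derivative f (at x) b)"
proof -
  have "Ck (Suc k) D f" for k using assms(1) unfolding smooth_fun_def by blast
  then show ?thesis using assms(2) unfolding smooth_fun_def by simp
qed

lemma frechet_derivative_differentiable_of_smooth_fun:
  assumes f: "smooth_fun D f" and D: "open D" "x \<in> D"
  shows "(\<lambda>y. frechet_derivative f (at y) v) differentiable (at x)"
proof -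
  let ?g = "\<lambda>y. \<Sum>b\<in>Basis. (v \<bullet> b) * frechet_derivative f (at y) b"
  have "(\<lambda>y. (v \<bullet> b) * frechet_derivative f (at y) b) differentiable (at x)" if "b \<in> Basis" for b
    using smooth_fun_differentiable[OF smooth_fun_frechet_derivative_Basis[OF f that] D] by simp
  then have "?g differentiable (at x)" by simp
  then obtain g' where g': "(?g has_derivative g') (at x)" unfolding differentiable_def by blast
  have g_eq: "?g y = frechet_derivative f (at y) v" if "y \<in> D" for y
  proof -
    have "linear (frechet_derivative f (at y))"
      using smooth_fun_differentiable[OF f D(1) that] by (rule linear_frechet_derivative)
    from linear_sum[OF this, of "\<lambda>b. (v \<bullet> b) *\<^sub>R b" Basis] show ?thesis
      by (simp add: euclidean_representation linear_cmul[OF \<open>linear _\<close>])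
  qed
  show ?thesis
    by (rule differentiableI, rule has_derivative_transform_within_open[OF g' D]) (rule g_eq)
qed

lemma frechet_derivative_continuous_of_smooth_fun:
  "smooth_fun D f \<Longrightarrow> open D \<Longrightarrow> continuous_on D (\<lambda>x. frechet_derivative f (at x) v)"
  by (intro continuous_at_imp_continuous_on ballI differentiable_imp_continuous_within
      frechet_derivative_differentiable_of_smooth_fun)

definition planar :: "real^4 \<Rightarrow> real \<times> real" where
  "planar p = (p $ 1, p $ 2)"

definition chart_point :: "real \<times> real \<Rightarrow> real \<Rightarrow> real \<Rightarrow> real^4" where
  "chart_point x \<theta> \<phi> = vector [fst x, snd x, \<theta>, \<phi>]"

lemma vector_4 [simp]:
  "(vector [a, b, c, d] :: 'a::zero^4) $ 1 = a" "(vector [a, b, c, d] :: 'a^4) $ 2 = b"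
  "(vector [a, b, c, d] :: 'a^4) $ 3 = c" "(vector [a, b, c, d] :: 'a^4) $ 4 = d"
  unfolding vector_def by simp_all

lemma chart_point_simps [simp]:
  "planar (chart_point x \<theta> \<phi>) = x" "chart_point x \<theta> \<phi> $ 3 = \<theta>" "chart_point x \<theta> \<phi> $ 4 = \<phi>"
  by (simp_all add: chart_point_def planar_def)

lemma vec_4_eq_iff_planar: "v = w \<longleftrightarrow> planar v = planar w \<and> v $ 3 = w $ 3 \<and> v $ 4 = (w $ 4 :: real)"
  by (auto simp: vec_eq_iff forall_4 planar_def)

lemma bounded_linear_planar: "bounded_linear planar"
  unfolding planar_def[abs_def] by (intro bounded_linear_Pair bounded_linear_vec_nth)

lemmas linear_planar = bounded_linear.linear[OF bounded_linear_planar]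

lemma planar_axis_34 [simp]: "planar (axis 3 a) = 0" "planar (axis 4 a) = 0"
  by (simp_all add: planar_def axis_def zero_prod_def)

lemma mem_chartdom_iff: "p \<in> chartdom D \<longleftrightarrow> planar p \<in> D \<and> 0 < p $ 3 \<and> p $ 3 < pi"
  by (simp add: chartdom_def planar_def)

lemma open_chartdom: "open D \<Longrightarrow> open (chartdom D)"
  unfolding chartdom_def
  by (intro open_Collect_conj open_Collect_less continuous_intros)
    (auto intro!: open_vimage[unfolded vimage_def] continuous_intros)

lemma lift2_eq: "lift2 f p = f (planar p)"
  by (simp add: lift2_def planar_def)

lemma has_vector_derivative_chart_point:
  assumes "(x has_vector_derivative x') (at t)"
    and "(\<theta> has_real_derivative \<theta>') (at t)" "(\<phi> has_real_derivative \<phi>') (at t)"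
  shows "((\<lambda>t. chart_point (x t) (\<theta> t) (\<phi> t)) has_vector_derivative chart_point x' \<theta>' \<phi>') (at t)"
  using bounded_linear.has_vector_derivative[OF bounded_linear_fst assms(1)]
    bounded_linear.has_vector_derivative[OF bounded_linear_snd assms(1)] assms(2,3)
  by (simp add: has_vector_derivative_componentwise_vec forall_4 chart_point_def
      has_real_derivative_iff_has_vector_derivative)

lemma has_derivative_lift2:
  assumes "f differentiable (at (planar p))"
  shows "(lift2 f has_derivative (\<lambda>v. frechet_derivative f (at (planar p)) (planar v))) (at p)"
  using has_derivative_compose[OF bounded_linear_imp_has_derivative[OF bounded_linear_planar]]
    assms[unfolded frechet_derivative_works] by (simp add: lift2_eq[abs_def])

lemma lift2_differentiable: "f differentiable (at (planar p)) \<Longrightarrow> lift2 f differentiable (at p)"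
  using has_derivative_lift2 differentiable_def by blast

lemma differential_lift2:
  "f differentiable (at (planar p)) \<Longrightarrow>
    differential (lift2 f) p v = frechet_derivative f (at (planar p)) (planar v)"
  using differential_eqI[OF has_derivative_lift2] by metis

lemma partial_lift2:
  assumes "f differentiable (at (planar p))"
  shows "partial i (lift2 f) p = frechet_derivative f (at (planar p)) (planar (axis i 1))"
  using differential_lift2[OF assms, of "axis i 1"] by (simp add: differential_axis)

lemma has_derivative_partial_lift2:
  fixes i :: 4
  assumes f: "smooth_fun D f" and "open D" and p: "p \<in> chartdom D"
  defines "g \<equiv> \<lambda>x. frechet_derivative f (at x) (planar (axis i 1))"
  shows "(partial i (lift2 f) has_derivative
    (\<lambda>v. frechet_derivative g (at (planar p)) (planar v))) (at p)"
proof (rule has_derivative_transform_within_open[OF _ open_chartdom[OF \<open>open D\<close>] p])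
  have "g differentiable (at (planar p))"
    using frechet_derivative_differentiable_of_smooth_fun[OF f \<open>open D\<close>] p
    by (simp add: g_def mem_chartdom_iff)
  then show "(lift2 g has_derivative (\<lambda>v. frechet_derivative g (at (planar p)) (planar v))) (at p)"
    by (rule has_derivative_lift2)
  show "lift2 g q = partial i (lift2 f) q" if "q \<in> chartdom D" for q
    using partial_lift2[of f q i] smooth_fun_differentiable[OF f \<open>open D\<close>] that
    by (simp add: mem_chartdom_iff lift2_eq g_def)
qed

lemma differential_lift2_scaleR:
  assumes "f differentiable (at (planar p))" "planar v = \<mu> *\<^sub>R planar k"
  shows "differential (lift2 f) p v = \<mu> * differential (lift2 f) p k"
  using assms linear_cmul[OF linear_frechet_derivative[OF assms(1)]]
  by (simp add: differential_lift2)

lemma partial_lift2_angular: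
  assumes "f differentiable (at (planar p))"
  shows "partial 3 (lift2 f) p = 0" "partial 4 (lift2 f) p = 0"
  by (simp_all add: partial_lift2[OF assms] linear_0[OF linear_frechet_derivative[OF assms]])

lemma second_differential_lift2_scaleR:
  assumes f: "smooth_fun D f" and D: "open D" and p: "p \<in> chartdom D"
    and v: "planar v = \<mu> *\<^sub>R planar k"
  shows "second_differential (lift2 f) p v = \<mu>\<^sup>2 * second_differential (lift2 f) p k"
proof -
  note deriv = has_derivative_partial_lift2[OF f D p]
  have scale: "differential (partial i (lift2 f)) p v = \<mu> * differential (partial i (lift2 f)) p k"
    for i
  proof -
    have "differential (partial i (lift2 f)) p v = differential (partial i (lift2 f)) p (\<mu> *\<^sub>R k)"
      unfolding differential_eqI[OF deriv] v linear_cmul[OF linear_planar] ..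
    then show ?thesis by (simp add: linear_cmul[OF linear_differential])
  qed
  have "differential (partial i (lift2 f)) p k = 0" if i: "planar (axis i 1) = 0" for i
  proof -
    have "partial i (lift2 f) q = 0" if "q \<in> chartdom D" for q
    proof -
      have "f differentiable (at (planar q))"
        using smooth_fun_differentiable[OF f D] that by (simp add: mem_chartdom_iff)
      then show ?thesis using i partial_lift2 linear_0[OF linear_frechet_derivative] by metis
    qed
    then have "(partial i (lift2 f) has_derivative (\<lambda>v. 0)) (at p)"
      by (intro has_derivative_transform_within_open[OF has_derivative_const open_chartdom[OF D] p])
        simp
    then show ?thesis using differential_eqI by metis
  qed
  then have "differential (partial 3 (lift2 f)) p k = 0"
    "differential (partial 4 (lift2 f)) p k = 0"
    by simp_all
  then show ?thesis
    using v by (simp add: second_differential_def sum_4 scale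
        planar_def power2_eq_square algebra_simps)
qed

subsection \<open>The metric and the photon condition\<close>

lemma sss_metric_nth:
  "sss_metric a b c d p $ 1 $ 1 = lift2 a p" "sss_metric a b c d p $ 1 $ 2 = lift2 b p"
  "sss_metric a b c d p $ 1 $ 3 = 0" "sss_metric a b c d p $ 1 $ 4 = 0"
  "sss_metric a b c d p $ 2 $ 1 = lift2 b p" "sss_metric a b c d p $ 2 $ 2 = lift2 c p"
  "sss_metric a b c d p $ 2 $ 3 = 0" "sss_metric a b c d p $ 2 $ 4 = 0"
  "sss_metric a b c d p $ 3 $ 1 = 0" "sss_metric a b c d p $ 3 $ 2 = 0"
  "sss_metric a b c d p $ 3 $ 3 = lift2 d p" "sss_metric a b c d p $ 3 $ 4 = 0"
  "sss_metric a b c d p $ 4 $ 1 = 0" "sss_metric a b c d p $ 4 $ 2 = 0"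
  "sss_metric a b c d p $ 4 $ 3 = 0" "sss_metric a b c d p $ 4 $ 4 = lift2 d p * (sin (p $ 3))\<^sup>2"
  by (simp_all add: sss_metric_def)

lemma sss_metric_symmetric: "sss_metric a b c d p $ i $ j = sss_metric a b c d p $ j $ i"
proof -
  have "\<forall>i j. sss_metric a b c d p $ i $ j = sss_metric a b c d p $ j $ i"
    by (simp add: forall_4 sss_metric_nth)
  then show ?thesis by blast
qed

definition angular_norm_sq :: "real^4 \<Rightarrow> real^4 \<Rightarrow> real" where
  "angular_norm_sq p v = (v $ 3)\<^sup>2 + (sin (p $ 3))\<^sup>2 * (v $ 4)\<^sup>2"

definition kodama_vector :: "(real^4 \<Rightarrow> real^4^4) \<Rightarrow> (real^4 \<Rightarrow> real) \<Rightarrow> real^4 \<Rightarrow> real^4" where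
  "kodama_vector G f p = (\<chi> a. \<Sum>b\<in>UNIV. eps2 G p a b * partial b f p)"

lemma gform_sss_metric:
  "gform (sss_metric g00 g01 g11 gth) p v w =
     lift2 g00 p * v $ 1 * w $ 1 + lift2 g01 p * (v $ 1 * w $ 2 + v $ 2 * w $ 1)
     + lift2 g11 p * v $ 2 * w $ 2
     + lift2 gth p * (v $ 3 * w $ 3 + (sin (p $ 3))\<^sup>2 * v $ 4 * w $ 4)"
  by (simp add: gform_def sum_4 sss_metric_nth algebra_simps)

lemma photon_condition_iff_hess_form:
  "photon_condition G r gth p \<longleftrightarrow>
     2 * gth p * hess_form G r p (kodama_vector G r p)
       + differential r p (gradient G r p) * differential gth p (gradient G r p) = 0"
proof -
  have "(\<Sum>a\<in>UNIV. \<Sum>b\<in>UNIV. \<Sum>c\<in>UNIV. \<Sum>d\<in>UNIV.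
         eps2 G p a b * eps2 G p c d * hess G r p a c * partial b r p * partial d r p)
     = hess_form G r p (kodama_vector G r p)"
    unfolding hess_form_def kodama_vector_def vec_lambda_beta sum_distrib_left sum_distrib_right
    by (subst (2) sum.swap, subst (3) sum.swap) (simp add: algebra_simps)
  moreover have "(\<Sum>a\<in>UNIV. \<Sum>b\<in>UNIV. ginv G p a b * partial a r p * partial b r p)
      = differential r p (gradient G r p)"
    by (simp add: differential_def gradient_def sum_distrib_left algebra_simps)
  moreover have "(\<Sum>c\<in>UNIV. \<Sum>d\<in>UNIV. ginv G p c d * partial d r p * partial c gth p)
      = differential gth p (gradient G r p)"
    by (simp add: differential_def gradient_def sum_distrib_left algebra_simps)
  ultimately show ?thesis by (simp add: photon_condition_def)
qed

locale sss_chart =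
  fixes D :: "(real \<times> real) set" and g00 g01 g11 gth :: "real \<times> real \<Rightarrow> real"
  assumes D_open: "open D"
    and metric_smooth: "smooth_fun D g00" "smooth_fun D g01" "smooth_fun D g11" "smooth_fun D gth"
    and gth_pos: "x \<in> D \<Longrightarrow> gth x > 0"
    and lorentzian: "x \<in> D \<Longrightarrow> g00 x * g11 x - (g01 x)\<^sup>2 < 0"
begin

abbreviation "G \<equiv> sss_metric g00 g01 g11 gth"
abbreviation "U \<equiv> chartdom D"

lemma smooth_differentiable_planar:
  "smooth_fun D f \<Longrightarrow> p \<in> U \<Longrightarrow> f differentiable (at (planar p))"
  using smooth_fun_differentiable D_open by (auto simp: mem_chartdom_iff)

lemma metric_lift2_differentiable:
  assumes "p \<in> U"
  shows "lift2 g00 differentiable (at p)" "lift2 g01 differentiable (at p)"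
    "lift2 g11 differentiable (at p)" "lift2 gth differentiable (at p)"
  using metric_smooth smooth_differentiable_planar assms lift2_differentiable by blast+

lemma metric_signs:
  assumes "p \<in> U"
  shows "lift2 gth p > 0" "lift2 g00 p * lift2 g11 p - (lift2 g01 p)\<^sup>2 < 0" "sin (p $ 3) > 0"
  using assms gth_pos lorentzian by (auto simp: mem_chartdom_iff lift2_eq sin_gt_zero)

lemma has_derivative_metric_44:
  assumes "p \<in> U"
  shows "((\<lambda>q. lift2 gth q * (sin (q $ 3))\<^sup>2) has_derivative
    (\<lambda>v. (sin (p $ 3))\<^sup>2 * differential (lift2 gth) p v
      + 2 * lift2 gth p * sin (p $ 3) * cos (p $ 3) * v $ 3)) (at p)"
proof -
  have "((\<lambda>q::real^4. q $ 3) has_derivative (\<lambda>v. v $ 3)) (at p)"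
    by (intro bounded_linear_imp_has_derivative bounded_linear_vec_nth)
  then show ?thesis
    using has_derivative_differential[OF metric_lift2_differentiable(4)[OF assms]]
    by (auto intro!: derivative_eq_intros simp: fun_eq_iff)
qed

lemma invertible_sss_metric:
  assumes "p \<in> U"
  shows "invertible (G p)"
proof -
  note signs = metric_signs[OF assms]
  have "x = 0" if "G p *v x = 0" for x
  proof -
    have radical: "gform G p v x = 0" for v using that by (simp add: gform_eq_inner)
    have rows: "lift2 g00 p * x $ 1 + lift2 g01 p * x $ 2 = 0"
      "lift2 g01 p * x $ 1 + lift2 g11 p * x $ 2 = 0"
      using radical[of "axis 1 1"] radical[of "axis 2 1"]
      by (simp_all add: gform_sss_metric axis_def)
    have "(lift2 g00 p * lift2 g11 p - (lift2 g01 p)\<^sup>2) * x $ 1 = 0"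
      "(lift2 g00 p * lift2 g11 p - (lift2 g01 p)\<^sup>2) * x $ 2 = 0"
      using rows by algebra+
    moreover have "x $ 3 = 0" "x $ 4 = 0"
      using radical[of "axis 3 1"] radical[of "axis 4 1"] signs
      by (simp_all add: gform_sss_metric axis_def)
    ultimately show ?thesis using signs(2) by (simp add: vec_eq_iff forall_4)
  qed
  then show ?thesis using invertible_left_inverse matrix_left_invertible_ker by blast
qed

sublocale semi_riemannian_chart G U
proof
  show "G q $ i $ j = G q $ j $ i" for q i j by (rule sss_metric_symmetric)
  show "invertible (G p)" if "p \<in> U" for p using that by (rule invertible_sss_metric)
  show "(\<lambda>q. G q $ i $ j) differentiable (at p)" if "p \<in> U" for p i j
  proof -
    have "\<forall>i j. (\<lambda>q. G q $ i $ j) differentiable (at p)"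
      using metric_lift2_differentiable[OF that]
        differentiableI[OF has_derivative_metric_44[OF that]]
      by (simp add: forall_4 sss_metric_nth)
    then show ?thesis by blast
  qed
qed

lemma metric_derivative_sss_metric:
  assumes p: "p \<in> U"
  shows "metric_derivative G p u v w =
     differential (lift2 g00) p u * v $ 1 * w $ 1
     + differential (lift2 g01) p u * (v $ 1 * w $ 2 + v $ 2 * w $ 1)
     + differential (lift2 g11) p u * v $ 2 * w $ 2
     + differential (lift2 gth) p u * (v $ 3 * w $ 3 + (sin (p $ 3))\<^sup>2 * v $ 4 * w $ 4)
     + 2 * lift2 gth p * sin (p $ 3) * cos (p $ 3) * u $ 3 * v $ 4 * w $ 4"
  by (simp add: metric_derivative_def sum_4 sss_metric_nth
      differential_eqI[OF has_derivative_metric_44[OF p]] distrib_left distrib_right)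

lemma covariant_acceleration_angular:
  assumes p: "p \<in> U" and v: "differential (lift2 gth) p v = 0"
  shows "covariant_acceleration G p v a $ 3 = a $ 3 - sin (p $ 3) * cos (p $ 3) * (v $ 4)\<^sup>2"
    and "covariant_acceleration G p v a $ 4 = a $ 4 + 2 * cos (p $ 3) / sin (p $ 3) * v $ 3 * v $ 4"
proof -
  note signs = metric_signs[OF p]
  note lowered = gform_covariant_acceleration[OF p, of "axis i 1" v a for i,
      unfolded metric_derivative_sss_metric[OF p] gform_sss_metric differential_axis v]
  note angular =
    metric_smooth[THEN partial_lift2_angular(1)[OF smooth_differentiable_planar[OF _ p]]]
    metric_smooth[THEN partial_lift2_angular(2)[OF smooth_differentiable_planar[OF _ p]]]
  have "lift2 gth p * covariant_acceleration G p v a $ 3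
    = lift2 gth p * (a $ 3 - sin (p $ 3) * cos (p $ 3) * (v $ 4)\<^sup>2)"
    using lowered[of 3] angular by (simp add: axis_def algebra_simps power2_eq_square)
  then show "covariant_acceleration G p v a $ 3 = a $ 3 - sin (p $ 3) * cos (p $ 3) * (v $ 4)\<^sup>2"
    using signs(1) by simp
  have "lift2 gth p * (sin (p $ 3))\<^sup>2 * covariant_acceleration G p v a $ 4
    = lift2 gth p * (sin (p $ 3))\<^sup>2 * (a $ 4 + 2 * cos (p $ 3) / sin (p $ 3) * v $ 3 * v $ 4)"
    using lowered[of 4] angular signs(3) by (simp add: axis_def algebra_simps power2_eq_square)
  then show "covariant_acceleration G p v a $ 4
    = a $ 4 + 2 * cos (p $ 3) / sin (p $ 3) * v $ 3 * v $ 4"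
    using signs(1,3) by simp
qed

lemma gradient_lift2_angular:
  assumes p: "p \<in> U" and f: "smooth_fun D f"
  shows "gradient G (lift2 f) p $ 3 = 0" "gradient G (lift2 f) p $ 4 = 0"
  using gform_gradient[OF p, of "axis i 1" "lift2 f" for i, unfolded differential_axis, of 3]
    gform_gradient[OF p, of "axis i 1" "lift2 f" for i, unfolded differential_axis, of 4]
    partial_lift2_angular[OF smooth_differentiable_planar[OF f p]] metric_signs[OF p]
  by (simp_all add: gform_sss_metric axis_def)

lemma gform_planar_scaleR:
  assumes "planar v = \<mu> *\<^sub>R planar k" "k $ 3 = 0" "k $ 4 = 0"
  shows "gform G p v v = \<mu>\<^sup>2 * gform G p k k + lift2 gth p * angular_norm_sq p v"
    and "gform G p k v = \<mu> * gform G p k k"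
  using assms by (auto simp: gform_sss_metric planar_def angular_norm_sq_def
      algebra_simps power2_eq_square)

lemma hess_form_planar_scaleR:
  assumes p: "p \<in> U" and r: "smooth_fun D r"
    and v: "planar v = \<mu> *\<^sub>R planar k" and k: "k $ 3 = 0" "k $ 4 = 0"
  shows "hess_form G (lift2 r) p v = \<mu>\<^sup>2 * hess_form G (lift2 r) p k
    + differential (lift2 gth) p (gradient G (lift2 r) p) * angular_norm_sq p v / 2"
proof -
  have scale: "differential (lift2 f) p v = \<mu> * differential (lift2 f) p k"
    if "smooth_fun D f" for f
    using differential_lift2_scaleR[OF smooth_differentiable_planar[OF that p] v] .
  show ?thesis
    using v unfolding hess_form_eq_metric_derivative[OF p] metric_derivative_sss_metric[OF p]
      second_differential_lift2_scaleR[OF r D_open p v] metric_smooth[THEN scale]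
    by (simp add: planar_def k gradient_lift2_angular[OF p r] angular_norm_sq_def
        field_simps power2_eq_square)
qed

lemma kodama_vector_nth:
  fixes p :: "real^4" and r :: "real \<times> real \<Rightarrow> real"
  defines "s \<equiv> 1 / sqrt (- (lift2 g00 p * lift2 g11 p - (lift2 g01 p)\<^sup>2))"
  shows "kodama_vector G (lift2 r) p $ 1 = s * partial 2 (lift2 r) p"
    "kodama_vector G (lift2 r) p $ 2 = - s * partial 1 (lift2 r) p"
    "kodama_vector G (lift2 r) p $ 3 = 0" "kodama_vector G (lift2 r) p $ 4 = 0"
  by (simp_all add: kodama_vector_def eps2_def sum_4 sss_metric_nth s_def)

lemma angular_norm_sq_eq_0_iff: "p \<in> U \<Longrightarrow> angular_norm_sq p v = 0 \<longleftrightarrow> v $ 3 = 0 \<and> v $ 4 = 0"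
  using metric_signs(3)[of p] by (auto simp: angular_norm_sq_def add_nonneg_eq_0_iff)

lemma null_vector_planar_nonzero:
  assumes p: "p \<in> U" and k: "gform G p k k = 0" "k \<noteq> 0"
  shows "planar k \<noteq> 0"
proof
  assume "planar k = 0"
  then have "k $ 3 = 0 \<and> k $ 4 = 0"
    using gform_planar_scaleR(1)[of k 0 0 p] k(1) metric_signs(1)[OF p]
    by (simp add: angular_norm_sq_eq_0_iff[OF p])
  with \<open>planar k = 0\<close> k(2) show False
    by (simp add: vec_4_eq_iff_planar linear_0[OF linear_planar])
qed

lemma level_vectors_planar_scaleR:
  assumes p: "p \<in> U" and r: "smooth_fun D r" and dr: "differential (lift2 r) p \<noteq> (\<lambda>_. 0)"
    and k: "differential (lift2 r) p k = 0" "planar k \<noteq> 0" and v: "differential (lift2 r) p v = 0"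
  obtains \<mu> where "planar v = \<mu> *\<^sub>R planar k"
proof -
  note diff = smooth_differentiable_planar[OF r p]
  have "frechet_derivative r (at (planar p)) \<noteq> (\<lambda>_. 0)"
    using dr by (auto simp: differential_lift2[OF diff])
  moreover have "frechet_derivative r (at (planar p)) (planar k) = 0"
    "frechet_derivative r (at (planar p)) (planar v) = 0"
    using k(1) v by (simp_all add: differential_lift2[OF diff])
  moreover have "DIM(real \<times> real) = 2" by simp
  ultimately show ?thesis
    using linear_functional_kernel_plane linear_frechet_derivative[OF diff] k(2) that by blast
qed

lemma gform_kodama_vector:
  assumes p: "p \<in> U" and r: "smooth_fun D r"
  defines "T \<equiv> kodama_vector G (lift2 r) p" and "n \<equiv> gradient G (lift2 r) p"
  shows "gform G p T T = - differential (lift2 r) p n" "differential (lift2 r) p T = 0"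
proof -
  define \<Delta> where "\<Delta> = lift2 g00 p * lift2 g11 p - (lift2 g01 p)\<^sup>2"
  define s where "s = 1 / sqrt (- \<Delta>)"
  have s: "s\<^sup>2 * \<Delta> = - 1"
    using metric_signs(2)[OF p, folded \<Delta>_def] by (simp add: s_def power_divide)
  have T: "T $ 1 = s * partial 2 (lift2 r) p" "T $ 2 = - s * partial 1 (lift2 r) p"
    "T $ 3 = 0" "T $ 4 = 0"
    using kodama_vector_nth[of r p] by (simp_all add: T_def s_def \<Delta>_def)
  note angular = partial_lift2_angular[OF smooth_differentiable_planar[OF r p]]
  show "differential (lift2 r) p T = 0" by (simp add: differential_def sum_4 T)
  have dr: "partial 1 (lift2 r) p = lift2 g00 p * n $ 1 + lift2 g01 p * n $ 2"
    "partial 2 (lift2 r) p = lift2 g01 p * n $ 1 + lift2 g11 p * n $ 2"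
    using gform_gradient[OF p, of "axis 1 1" "lift2 r"]
      gform_gradient[OF p, of "axis 2 1" "lift2 r"]
    by (simp_all add: differential_axis n_def gform_sss_metric) (simp_all add: axis_def)
  have "gform G p T T = s\<^sup>2 * \<Delta> * differential (lift2 r) p n"
    unfolding differential_def sum_4 angular gform_sss_metric T dr \<Delta>_def by algebra
  then show "gform G p T T = - differential (lift2 r) p n" using s by simp
qed

lemma planar_kodama_vector_eq_0:
  assumes p: "p \<in> U" and r: "smooth_fun D r" and T: "planar (kodama_vector G (lift2 r) p) = 0"
  shows "differential (lift2 r) p = (\<lambda>_. 0)"
proof -
  have "partial 1 (lift2 r) p = 0" "partial 2 (lift2 r) p = 0"
    using T metric_signs(2)[OF p] kodama_vector_nth(1,2)[of r p]
    by (auto simp: planar_def zero_prod_def)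
  then show ?thesis
    using partial_lift2_angular[OF smooth_differentiable_planar[OF r p]]
    by (simp add: fun_eq_iff differential_def sum_4)
qed

lemma photon_condition_iff_hess_form_null:
  assumes p: "p \<in> U" and r: "smooth_fun D r" and dr: "differential (lift2 r) p \<noteq> (\<lambda>_. 0)"
    and k: "k \<noteq> 0" "gform G p k k = 0" "differential (lift2 r) p k = 0"
  shows "photon_condition G (lift2 r) (lift2 gth) p \<longleftrightarrow> hess_form G (lift2 r) p k = 0"
proof -
  define T where "T = kodama_vector G (lift2 r) p"
  define n where "n = gradient G (lift2 r) p"
  define A where "A = angular_norm_sq p k"
  have T34: "T $ 3 = 0" "T $ 4 = 0" using kodama_vector_nth[of r p] by (simp_all add: T_def)
  have "planar T \<noteq> 0"
    using dr planar_kodama_vector_eq_0[OF p r] by (auto simp: T_def)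
  then obtain \<mu> where \<mu>: "planar k = \<mu> *\<^sub>R planar T"
    using level_vectors_planar_scaleR[OF p r dr _ _ k(3)] gform_kodama_vector(2)[OF p r]
    by (auto simp: T_def)
  have null: "lift2 gth p * A = \<mu>\<^sup>2 * differential (lift2 r) p n"
    using k(2) gform_planar_scaleR(1)[OF \<mu> T34, of p] gform_kodama_vector(1)[OF p r]
    by (simp add: A_def T_def n_def)
  have "\<mu> \<noteq> 0" using null_vector_planar_nonzero[OF p k(2,1)] \<mu> by auto
  have "2 * lift2 gth p * hess_form G (lift2 r) p k
    = 2 * lift2 gth p * \<mu>\<^sup>2 * hess_form G (lift2 r) p T
        + differential (lift2 gth) p n * (lift2 gth p * A)"
    unfolding hess_form_planar_scaleR[OF p r \<mu> T34] by (simp add: A_def n_def algebra_simps)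
  also have "\<dots> = \<mu>\<^sup>2 * (2 * lift2 gth p * hess_form G (lift2 r) p T
      + differential (lift2 r) p n * differential (lift2 gth) p n)"
    unfolding null by (simp add: algebra_simps)
  finally show ?thesis
    using \<open>\<mu> \<noteq> 0\<close> metric_signs(1)[OF p] unfolding photon_condition_iff_hess_form T_def n_def
    by (metis mult_eq_0_iff less_irrefl power_not_zero zero_neq_numeral)
qed

end

subsection \<open>Invariant hypersurfaces\<close>

lemma saturated_empty_interior_imp_constant_on:
  fixes r :: "'a::topological_space \<Rightarrow> real"
  assumes B: "open B" and r: "continuous_on B r"
    and saturated: "\<And>y z. y \<in> B \<inter> C \<Longrightarrow> z \<in> B \<Longrightarrow> r z = r y \<Longrightarrow> z \<in> C"
    and C: "interior C = {}" and X: "connected X" "X \<subseteq> B \<inter> C"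
  shows "r constant_on X"
proof (rule ccontr)
  assume "\<not> r constant_on X"
  then obtain y z where yz: "y \<in> X" "z \<in> X" "r y < r z"
    unfolding constant_on_def by (metis linorder_neqE)
  have "connected (r ` X)"
    using X r by (intro connected_continuous_image) (auto intro: continuous_on_subset)
  then have between: "{r y..r z} \<subseteq> r ` X" using yz by (simp add: connected_contains_Icc)
  define W where "W = B \<inter> r -` {r y<..<r z}"
  have "open W" unfolding W_def using r B by (intro continuous_open_preimage) auto
  moreover have "W \<subseteq> C"
  proof
    fix w assume w: "w \<in> W"
    then have "r w \<in> r ` X" using between by (auto simp: W_def)
    then show "w \<in> C" using saturated w X(2) by (auto simp: W_def)
  qed
  ultimately have "W = {}" using C interior_maximal by blast
  obtain m where m: "r y < m" "m < r z" using dense yz(3) by blast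
  then have "m \<in> r ` X" using between by auto
  then have "W \<noteq> {}" using m X(2) by (auto simp: W_def)
  with \<open>W = {}\<close> show False by simp
qed

locale sss_hypersurface = sss_chart +
  fixes r K0 K1 :: "real \<times> real \<Rightarrow> real" and \<Phi> :: "real^3 \<Rightarrow> real^4" and V :: "(real^3) set"
  assumes r_smooth: "smooth_fun D r" and K_smooth: "smooth_fun D K0" "smooth_fun D K1"
    and K_nonzero: "x \<in> D \<Longrightarrow> (K0 x, K1 x) \<noteq> (0, 0)"
    and K_killing: "killing_field G U (vf2 K0 K1)"
    and r_invariant: "p \<in> U \<Longrightarrow> differential (lift2 r) p (vf2 K0 K1 p) = 0"
    and S_timelike: "timelike_hypersurface G U \<Phi> V"
    and S_so3: "so3_invariant U (\<Phi> ` V)"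
    and S_R: "flow_invariant (vf2 K0 K1) U (\<Phi> ` V)"
    and gradient_nonzero: "u \<in> V \<Longrightarrow> gradient G (lift2 r) (\<Phi> u) \<noteq> 0"
begin

abbreviation "K \<equiv> vf2 K0 K1"
abbreviation "planar_K \<equiv> \<lambda>x. (K0 x, K1 x)"

definition profile :: "(real \<times> real) set" where
  "profile = planar ` \<Phi> ` V"

lemma K_eq_chart_point: "K p = chart_point (planar_K (planar p)) 0 0"
  by (simp add: vf2_def chart_point_def planar_def)

lemma K_simps [simp]: "planar (K p) = planar_K (planar p)" "K p $ 3 = 0" "K p $ 4 = 0"
  by (simp_all add: K_eq_chart_point)

lemma immersed: "open V" "\<Phi> ` V \<subseteq> U" "\<And>u. u \<in> V \<Longrightarrow> \<Phi> differentiable (at u)"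
    "\<And>u. u \<in> V \<Longrightarrow> inj (frechet_derivative \<Phi> (at u))"
  using S_timelike unfolding timelike_hypersurface_def immersed_hypersurface_def by auto

lemma differential_r_nonzero: "u \<in> V \<Longrightarrow> differential (lift2 r) (\<Phi> u) \<noteq> (\<lambda>_. 0)"
proof
  assume "u \<in> V" "differential (lift2 r) (\<Phi> u) = (\<lambda>_. 0)"
  then have "partial i (lift2 r) (\<Phi> u) = 0" for i by (simp flip: differential_axis)
  then show False using gradient_nonzero[OF \<open>u \<in> V\<close>] by (simp add: gradient_def vec_eq_iff)
qed

lemma mem_S_iff: "p \<in> \<Phi> ` V \<longleftrightarrow> p \<in> U \<and> planar p \<in> profile"
proof
  assume "p \<in> U \<and> planar p \<in> profile"
  then obtain q where "p \<in> U" "q \<in> \<Phi> ` V" "planar p = planar q" by (auto simp: profile_def)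
  then show "p \<in> \<Phi> ` V"
    using S_so3 immersed(2) unfolding so3_invariant_def planar_def by blast
qed (use immersed(2) in \<open>auto simp: profile_def\<close>)

lemma profile_subset: "profile \<subseteq> D"
  using immersed(2) by (auto simp: profile_def mem_chartdom_iff)

lemma interior_profile: "interior profile = {}"
proof -
  have "negligible (\<Phi> ` V)"
    by (rule negligible_differentiable_image_lowdim)
      (auto intro!: differentiable_at_imp_differentiable_on immersed)
  moreover have "chartdom (interior profile) \<subseteq> \<Phi> ` V"
    using interior_subset[of profile] profile_subset unfolding subset_iff mem_S_iff mem_chartdom_iff
    by blast
  ultimately have "chartdom (interior profile) = {}"
    using open_not_negligible open_chartdom[OF open_interior] negligible_subset by blast
  moreover have "chart_point x (pi / 2) 0 \<in> chartdom (interior profile)"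
    if "x \<in> interior profile" for x
    using that by (simp add: mem_chartdom_iff)
  ultimately show ?thesis by blast
qed

lemma integral_curve_in_profile:
  assumes \<sigma>: "integral_curve planar_K D J \<sigma>" "\<sigma> 0 \<in> profile" and t: "t \<in> J"
  shows "\<sigma> t \<in> profile"
proof -
  define \<tau> where "\<tau> s = chart_point (\<sigma> s) (pi / 2) 0" for s
  have \<tau>U: "\<tau> s \<in> U" if "s \<in> J" for s
    using \<sigma>(1) that by (simp add: \<tau>_def mem_chartdom_iff integral_curve_def)
  have "(\<tau> has_vector_derivative K (\<tau> s)) (at s within J)" if "s \<in> J" for s
    unfolding \<tau>_def K_eq_chart_point using \<sigma>(1) that
    by (intro has_vector_derivative_at_within[OF has_vector_derivative_chart_point])
      (auto simp: integral_curve_def)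
  moreover have "is_interval J" "0 \<in> J" using \<sigma>(1) by (auto simp: integral_curve_def)
  moreover from this have "\<tau> 0 \<in> \<Phi> ` V" using \<sigma>(2) \<tau>U by (simp add: mem_S_iff \<tau>_def)
  ultimately have "\<tau> t \<in> \<Phi> ` V"
    using S_R \<tau>U t unfolding flow_invariant_def by blast
  then show ?thesis by (simp add: mem_S_iff \<tau>_def)
qed

lemma profile_flow_box:
  assumes u: "u \<in> V"
  obtains B where "planar (\<Phi> u) \<in> B" "B \<subseteq> D" "level_flow_box planar_K r B"
proof (rule first_integral_level_flow_box[OF D_open])
  have p: "\<Phi> u \<in> U" using immersed(2) u by blast
  show x: "planar (\<Phi> u) \<in> D" using p by (simp add: mem_chartdom_iff)
  show "(r has_derivative frechet_derivative r (at x)) (at x)" if "x \<in> D" for x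
    using smooth_fun_differentiable[OF r_smooth D_open that] frechet_derivative_works by blast
  show "continuous_on D (\<lambda>x. frechet_derivative r (at x) v)" for v
    using frechet_derivative_continuous_of_smooth_fun[OF r_smooth D_open] .
  show "continuous_on D planar_K"
    using K_smooth by (intro continuous_on_Pair smooth_fun_continuous_on)
  show "planar_K (planar (\<Phi> u)) \<noteq> 0" using K_nonzero[OF x] by (simp add: zero_prod_def)
  show "frechet_derivative r (at x) (planar_K x) = 0" if "x \<in> D" for x
    using r_invariant[of "chart_point x (pi / 2) 0"]
      smooth_fun_differentiable[OF r_smooth D_open that] that
    by (simp add: differential_lift2 mem_chartdom_iff)
  show "frechet_derivative r (at (planar (\<Phi> u))) \<noteq> (\<lambda>_. 0)"
    using differential_r_nonzero[OF u]
      differential_lift2[OF smooth_differentiable_planar[OF r_smooth p]]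
    by auto
qed (use that in blast)

lemma r_constant_on_connected_profile:
  assumes u: "u \<in> V"
  obtains B where "open B" "planar (\<Phi> u) \<in> B"
    "\<And>X. connected X \<Longrightarrow> X \<subseteq> B \<inter> profile \<Longrightarrow> r constant_on X"
proof -
  obtain B where B: "planar (\<Phi> u) \<in> B" "B \<subseteq> D" "level_flow_box planar_K r B"
    using profile_flow_box[OF u] by blast
  have saturated: "z \<in> profile" if yz: "y \<in> B \<inter> profile" "z \<in> B" "r z = r y" for y z
  proof -
    obtain J \<sigma> t where \<sigma>: "integral_curve planar_K B J \<sigma>" "\<sigma> 0 = y" "t \<in> J" "\<sigma> t = z"
      using level_flow_boxE[OF B(3) _ yz(2,3)] yz(1) by blast
    then show ?thesis
      using integral_curve_in_profile[OF integral_curve_mono[OF \<sigma>(1) B(2)] _ \<sigma>(3)] \<sigma>(2,4) yz(1)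
      by simp
  qed
  have open_B: "open B" using B(3) by (simp add: level_flow_box_def)
  have "continuous_on B r"
    using smooth_fun_continuous_on[OF r_smooth] B(2) continuous_on_subset by blast
  have "r constant_on X" if "connected X" "X \<subseteq> B \<inter> profile" for X
    using open_B \<open>continuous_on B r\<close> saturated interior_profile that
    by (rule saturated_empty_interior_imp_constant_on)
  with open_B B(1) show ?thesis by (rule that)
qed

lemma differential_r_tangent:
  fixes f :: "'a::real_normed_vector \<Rightarrow> real^4"
  assumes A: "open A" "a \<in> A" and f: "f ` A \<subseteq> \<Phi> ` V" "continuous_on A f"
    and f': "(f has_derivative f') (at a)"
  shows "differential (lift2 r) (f a) (f' h) = 0"
proof -
  obtain u where u: "u \<in> V" "f a = \<Phi> u" using A(2) f(1) by blast
  have p: "f a \<in> U" using A(2) f(1) immersed(2) by blast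
  obtain B where B: "open B" "planar (f a) \<in> B"
    and const: "\<And>X. connected X \<Longrightarrow> X \<subseteq> B \<inter> profile \<Longrightarrow> r constant_on X"
    using r_constant_on_connected_profile[OF u(1)] u(2) by metis
  have cont: "continuous_on A (\<lambda>w. planar (f w))"
    using bounded_linear.continuous_on[OF bounded_linear_planar f(2)] .
  have "open (A \<inter> (\<lambda>w. planar (f w)) -` B)" using continuous_open_preimage[OF cont A(1) B(1)] .
  then obtain \<delta> where \<delta>: "\<delta> > 0" "ball a \<delta> \<subseteq> A \<inter> (\<lambda>w. planar (f w)) -` B"
    using A(2) B(2) open_contains_ball by blast
  have "connected ((\<lambda>w. planar (f w)) ` ball a \<delta>)"
    by (rule connected_continuous_image) (use cont \<delta> in \<open>auto intro: continuous_on_subset\<close>)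
  moreover have "(\<lambda>w. planar (f w)) ` ball a \<delta> \<subseteq> B \<inter> profile"
    using \<delta>(2) f(1) mem_S_iff by blast
  ultimately obtain c where c: "\<And>w. w \<in> ball a \<delta> \<Longrightarrow> lift2 r (f w) = c"
    using const unfolding constant_on_def lift2_eq by blast
  have "lift2 r differentiable (at (f a))"
    using lift2_differentiable smooth_differentiable_planar[OF r_smooth p] by blast
  from has_derivative_compose[OF f' has_derivative_differential[OF this]]
  have "((\<lambda>w. c) has_derivative (\<lambda>h. differential (lift2 r) (f a) (f' h))) (at a)"
    by (rule has_derivative_transform_within_open[of _ _ _ _ "ball a \<delta>"]) (use \<delta>(1) c in auto)
  from fun_cong[OF has_derivative_unique[OF this has_derivative_const]] show ?thesis .
qed

lemma tangent_space_eq: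
  assumes u: "u \<in> V"
  shows "tangent_space \<Phi> u = {v. differential (lift2 r) (\<Phi> u) v = 0}"
proof -
  let ?\<Phi>' = "frechet_derivative \<Phi> (at u)"
  have \<Phi>': "(\<Phi> has_derivative ?\<Phi>') (at u)"
    using immersed(3)[OF u] frechet_derivative_works by blast
  then have lin: "linear ?\<Phi>'" by (rule has_derivative_linear)
  have "continuous_on V \<Phi>"
    by (intro differentiable_imp_continuous_on differentiable_at_imp_differentiable_on immersed(3))
  then have sub: "tangent_space \<Phi> u \<subseteq> {v. differential (lift2 r) (\<Phi> u) v = 0}"
    using differential_r_tangent[OF immersed(1) u order.refl _ \<Phi>'] by (auto simp: tangent_space_def)
  define n where "n = (\<chi> i. partial i (lift2 r) (\<Phi> u))"
  have n: "differential (lift2 r) (\<Phi> u) v = n \<bullet> v" for v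
    by (simp add: n_def differential_def inner_vec_def)
  then have "n \<noteq> 0" using differential_r_nonzero[OF u] by (auto simp: fun_eq_iff)
  then have "dim {v. n \<bullet> v = 0} = 3" by (simp add: dim_hyperplane)
  moreover have "dim (range ?\<Phi>') = 3"
    using dim_image_eq[OF lin, of UNIV] immersed(4)[OF u] by (simp add: inj_on_def)
  ultimately show ?thesis
    using sub unfolding n tangent_space_def
    by (intro subspace_dim_equal) (auto simp: subspace_hyperplane linear_subspace_image[OF lin])
qed

lemma tangent_planar_scaleR_K:
  assumes u: "u \<in> V" and v: "differential (lift2 r) (\<Phi> u) v = 0"
  obtains \<mu> where "planar v = \<mu> *\<^sub>R planar (K (\<Phi> u))"
proof -
  have p: "\<Phi> u \<in> U" using immersed(2) u by blast
  then have "planar (K (\<Phi> u)) \<noteq> 0" using K_nonzero by (auto simp: mem_chartdom_iff zero_prod_def)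
  then show ?thesis
    using level_vectors_planar_scaleR[OF p r_smooth differential_r_nonzero[OF u]
        r_invariant[OF p] _ v] that
    by blast
qed

lemma K_timelike:
  assumes u: "u \<in> V"
  shows "gform G (\<Phi> u) (K (\<Phi> u)) (K (\<Phi> u)) < 0"
proof -
  have p: "\<Phi> u \<in> U" using immersed(2) u by blast
  obtain v where v: "v \<in> tangent_space \<Phi> u" "gform G (\<Phi> u) v v < 0"
    using S_timelike u unfolding timelike_hypersurface_def by blast
  then have "differential (lift2 r) (\<Phi> u) v = 0" using tangent_space_eq[OF u] by blast
  then obtain \<mu> where "planar v = \<mu> *\<^sub>R planar (K (\<Phi> u))"
    using tangent_planar_scaleR_K[OF u] by blast
  then have "gform G (\<Phi> u) v v
      = \<mu>\<^sup>2 * gform G (\<Phi> u) (K (\<Phi> u)) (K (\<Phi> u)) + lift2 gth (\<Phi> u) * angular_norm_sq (\<Phi> u) v"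
    by (intro gform_planar_scaleR(1)) simp_all
  moreover have "lift2 gth (\<Phi> u) * angular_norm_sq (\<Phi> u) v \<ge> 0"
    using metric_signs(1)[OF p] by (simp add: angular_norm_sq_def)
  ultimately have "\<mu>\<^sup>2 * gform G (\<Phi> u) (K (\<Phi> u)) (K (\<Phi> u)) < 0" using v(2) by linarith
  then show ?thesis by (simp add: mult_less_0_iff)
qed

lemma differential_r_planar_scaleR_K:
  "p \<in> U \<Longrightarrow> planar v = \<mu> *\<^sub>R planar (K p) \<Longrightarrow> differential (lift2 r) p v = 0"
  using differential_lift2_scaleR[OF smooth_differentiable_planar[OF r_smooth]] r_invariant
  by (metis mult_zero_right)

lemma partial_r_differentiable: "p \<in> U \<Longrightarrow> partial i (lift2 r) differentiable (at p)"
  using has_derivative_partial_lift2[OF r_smooth D_open] by (rule differentiableI)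

lemma geodesic_in_S_hess_form_eq_0:
  assumes geo: "geodesic G U {-\<epsilon><..<\<epsilon>} \<gamma>" and \<epsilon>: "\<epsilon> > 0"
    and \<gamma>'0: "(\<gamma> has_vector_derivative k) (at 0)" and \<gamma>S: "\<gamma> ` {-\<epsilon><..<\<epsilon>} \<subseteq> \<Phi> ` V"
  shows "hess_form G (lift2 r) (\<gamma> 0) k = 0"
proof -
  let ?I = "{-\<epsilon><..<\<epsilon>}"
  obtain \<gamma>' \<gamma>'' where \<gamma>': "\<And>t. t \<in> ?I \<Longrightarrow> (\<gamma> has_vector_derivative \<gamma>' t) (at t)"
    and \<gamma>'': "\<And>t. t \<in> ?I \<Longrightarrow> (\<gamma>' has_vector_derivative \<gamma>'' t) (at t)"
    and eq: "\<And>t. t \<in> ?I \<Longrightarrow> covariant_acceleration G (\<gamma> t) (\<gamma>' t) (\<gamma>'' t) = 0"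
    using geo unfolding geodesic_iff_covariant_acceleration by blast
  have zero_in: "0 \<in> ?I" using \<epsilon> by simp
  have "\<gamma> 0 \<in> U" using \<gamma>S zero_in immersed(2) by blast
  have "continuous_on ?I \<gamma>"
    by (intro continuous_at_imp_continuous_on ballI has_vector_derivative_continuous[OF \<gamma>'])
  then have level: "differential (lift2 r) (\<gamma> t) (\<gamma>' t) = 0" if "t \<in> ?I" for t
    using differential_r_tangent[OF _ that \<gamma>S _ \<gamma>'[OF that,
        unfolded has_vector_derivative_def], of 1]
    by simp
  note DERIV_differential_along_curve[where G = G, OF \<gamma>'[OF zero_in] \<gamma>''[OF zero_in]
      partial_r_differentiable[OF \<open>\<gamma> 0 \<in> U\<close>]]
  from DERIV_const_on_open[OF this open_greaterThanLessThan zero_in level]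
  have "hess_form G (lift2 r) (\<gamma> 0) (\<gamma>' 0) = 0"
    using eq[OF zero_in] by (simp add: linear_0[OF linear_differential])
  then show ?thesis using vector_derivative_unique_at[OF \<gamma>'[OF zero_in] \<gamma>'0] by simp
qed

lemma null_tangent_vector_exists:
  assumes u: "u \<in> V"
  obtains k where "k \<in> tangent_space \<Phi> u" "k \<noteq> 0" "gform G (\<Phi> u) k k = 0"
proof -
  define p where "p = \<Phi> u"
  have p: "p \<in> U" using immersed(2) u by (auto simp: p_def)
  define N where "N = gform G p (K p) (K p)"
  define k where "k = chart_point (planar (K p)) (sqrt (- N / lift2 gth p)) 0"
  have k: "planar k = 1 *\<^sub>R planar (K p)" by (simp add: k_def)
  have "- N / lift2 gth p > 0"
    using K_timelike[OF u] metric_signs(1)[OF p] by (simp add: N_def p_def divide_neg_pos)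
  then have "k \<noteq> 0" "gform G p k k = 0"
    using gform_planar_scaleR(1)[OF k, of p] metric_signs(1)[OF p]
    by (auto simp: k_def vec_4_eq_iff_planar angular_norm_sq_def N_def[symmetric])
  moreover have "k \<in> tangent_space \<Phi> u"
    using differential_r_planar_scaleR_K[OF p k] tangent_space_eq[OF u] by (simp add: p_def)
  ultimately show ?thesis using that by (simp add: p_def)
qed

lemma photon_condition_iff_hess_form_tangent:
  assumes u: "u \<in> V" and k: "k \<in> tangent_space \<Phi> u" "k \<noteq> 0" "gform G (\<Phi> u) k k = 0"
  shows "photon_condition G (lift2 r) (lift2 gth) (\<Phi> u) \<longleftrightarrow> hess_form G (lift2 r) (\<Phi> u) k = 0"
proof (rule photon_condition_iff_hess_form_null[OF _ r_smooth differential_r_nonzero[OF u] k(2,3)])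
  show "\<Phi> u \<in> U" using immersed(2) u by blast
  show "differential (lift2 r) (\<Phi> u) k = 0" using k(1) tangent_space_eq[OF u] by blast
qed

lemma photon_surface_imp_photon_condition:
  assumes photon: "photon_surface G U \<Phi> V" and u: "u \<in> V"
  shows "photon_condition G (lift2 r) (lift2 gth) (\<Phi> u)"
proof -
  obtain k where k: "k \<in> tangent_space \<Phi> u" "k \<noteq> 0" "gform G (\<Phi> u) k k = 0"
    using null_tangent_vector_exists[OF u] by blast
  then obtain \<epsilon> \<gamma> where "\<epsilon> > 0" "geodesic G U {-\<epsilon><..<\<epsilon>} \<gamma>" "\<gamma> 0 = \<Phi> u"
    "(\<gamma> has_vector_derivative k) (at 0)" "\<gamma> ` {-\<epsilon><..<\<epsilon>} \<subseteq> \<Phi> ` V"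
    using photon u unfolding photon_surface_def by blast
  then show ?thesis
    using geodesic_in_S_hess_form_eq_0 photon_condition_iff_hess_form_tangent[OF u k] by metis
qed

lemma K_nth_differentiable:
  assumes "p \<in> U"
  shows "(\<lambda>q. K q $ i) differentiable (at p)"
proof -
  have "(\<lambda>q. K q $ 1) = lift2 K0" "(\<lambda>q. K q $ 2) = lift2 K1"
    by (simp_all add: vf2_def lift2_def fun_eq_iff)
  then have "\<forall>i. (\<lambda>q. K q $ i) differentiable (at p)"
    using K_smooth[THEN smooth_differentiable_planar, OF assms] lift2_differentiable
    by (simp add: forall_4)
  then show ?thesis by blast
qed

lemma differential_gth_planar_scaleR_K:
  assumes p: "p \<in> U" and v: "planar v = \<mu> *\<^sub>R planar (K p)"
  shows "differential (lift2 gth) p v = 0"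
proof -
  have "differential (lift2 gth) p (K p) = 0"
    using K_killing[unfolded killing_field_def, rule_format, OF p, of 3 3]
    by (simp add: sum_4 sss_metric_nth differential_def mult.commute)
  then show ?thesis
    using differential_lift2_scaleR[OF smooth_differentiable_planar[OF metric_smooth(4) p] v]
    by simp
qed

lemma differential_K_norm_planar_scaleR_K:
  assumes p: "p \<in> U" and v: "planar v = \<mu> *\<^sub>R planar (K p)"
  shows "differential (\<lambda>q. gform G q (K q) (K q)) p v = 0"
proof -
  define N where "N x = g00 x * (K0 x)\<^sup>2 + 2 * g01 x * K0 x * K1 x + g11 x * (K1 x)\<^sup>2" for x
  have N: "(\<lambda>q. gform G q (K q) (K q)) = lift2 N"
    by (simp add: fun_eq_iff gform_sss_metric N_def lift2_def vf2_def
        algebra_simps power2_eq_square)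
  have "N differentiable (at (planar p))"
    unfolding N_def using metric_smooth K_smooth smooth_differentiable_planar[OF _ p] by simp
  from differential_lift2_scaleR[OF this v] show ?thesis
    using differential_killing_norm[OF K_killing p K_nth_differentiable[OF p]] unfolding N by simp
qed

lemma level_vector_orthogonal_K_eq_0:
  assumes u: "u \<in> V" and w: "differential (lift2 r) (\<Phi> u) w = 0" "w $ 3 = 0" "w $ 4 = 0"
    and orth: "gform G (\<Phi> u) (K (\<Phi> u)) w = 0"
  shows "w = 0"
proof -
  obtain \<mu> where \<mu>: "planar w = \<mu> *\<^sub>R planar (K (\<Phi> u))"
    using tangent_planar_scaleR_K[OF u w(1)] .
  then have "\<mu> * gform G (\<Phi> u) (K (\<Phi> u)) (K (\<Phi> u)) = 0"
    using gform_planar_scaleR(2)[OF \<mu>] orth by simp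
  then have "\<mu> = 0" using K_timelike[OF u] by simp
  then show ?thesis using \<mu> w(2,3)
    by (simp add: vec_4_eq_iff_planar zero_prod_def linear_0[OF linear_planar])
qed

lemma orbit_curve_acceleration_level:
  assumes J: "open J" "t \<in> J" and U: "\<And>s. s \<in> J \<Longrightarrow> \<gamma> s \<in> U"
    and \<gamma>': "\<And>s. s \<in> J \<Longrightarrow> (\<gamma> has_vector_derivative \<gamma>' s) (at s)"
    and \<gamma>'_K: "\<And>s. s \<in> J \<Longrightarrow> planar (\<gamma>' s) = \<alpha> *\<^sub>R planar (K (\<gamma> s))"
    and \<gamma>'': "(\<gamma>' has_vector_derivative a) (at t)"
  shows "hess_form G (lift2 r) (\<gamma> t) (\<gamma>' t)
      + differential (lift2 r) (\<gamma> t) (covariant_acceleration G (\<gamma> t) (\<gamma>' t) a) = 0"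
    and "gform G (\<gamma> t) (K (\<gamma> t)) (covariant_acceleration G (\<gamma> t) (\<gamma>' t) a) = 0"
proof -
  let ?W = "covariant_acceleration G (\<gamma> t) (\<gamma>' t) a"
  note p = U[OF J(2)]
  have level: "differential (lift2 r) (\<gamma> s) (\<gamma>' s) = 0" if "s \<in> J" for s
    using differential_r_planar_scaleR_K U \<gamma>'_K that by blast
  note DERIV_differential_along_curve[OF \<gamma>'[OF J(2)] \<gamma>'' partial_r_differentiable[OF p]]
  from DERIV_const_on_open[OF this J level]
  show "hess_form G (lift2 r) (\<gamma> t) (\<gamma>' t) + differential (lift2 r) (\<gamma> t) ?W = 0" .
  note deriv = DERIV_killing_momentum[of K \<gamma> t,
      OF K_killing p K_nth_differentiable[OF p] \<gamma>'[OF J(2)] \<gamma>'']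
  have "((\<lambda>s. \<alpha> * gform G (\<gamma> s) (K (\<gamma> s)) (K (\<gamma> s))) has_real_derivative
      gform G (\<gamma> t) (K (\<gamma> t)) ?W) (at t)"
    by (rule has_field_derivative_transform_within_open[OF deriv J])
      (use gform_planar_scaleR(2)[OF \<gamma>'_K] in simp)
  moreover have "((\<lambda>s. \<alpha> * gform G (\<gamma> s) (K (\<gamma> s)) (K (\<gamma> s))) has_real_derivative \<alpha> * 0) (at t)"
    using has_real_derivative_differential[OF gform_differentiable[OF p K_nth_differentiable[OF p]]
        \<gamma>'[OF J(2)]]
      differential_K_norm_planar_scaleR_K[OF p \<gamma>'_K[OF J(2)]] by (intro DERIV_cmult) simp
  ultimately show "gform G (\<gamma> t) (K (\<gamma> t)) ?W = 0" using DERIV_unique by fastforce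
qed

definition planar_K_derivative :: "real \<times> real \<Rightarrow> real \<times> real \<Rightarrow> real \<times> real" where
  "planar_K_derivative y v = (frechet_derivative K0 (at y) v, frechet_derivative K1 (at y) v)"

lemma has_vector_derivative_planar_K:
  assumes "x t \<in> D" and x: "(x has_vector_derivative v) (at t)"
  shows "((\<lambda>s. planar_K (x s)) has_vector_derivative planar_K_derivative (x t) v) (at t)"
proof -
  have "((\<lambda>s. f (x s)) has_vector_derivative frechet_derivative f (at (x t)) v) (at t)"
    if "smooth_fun D f" for f
  proof -
    have "(f has_derivative frechet_derivative f (at (x t))) (at (x t))"
      using smooth_fun_differentiable[OF that D_open assms(1)] frechet_derivative_works by blast
    from has_real_derivative_compose_curve[OF this x] show ?thesis
      unfolding has_real_derivative_iff_has_vector_derivative .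
  qed
  then show ?thesis unfolding planar_K_derivative_def
    using K_smooth by (intro has_vector_derivative_Pair)
qed

lemma profile_orbit_exists:
  assumes u: "u \<in> V"
  obtains \<delta> x where "\<delta> > 0" "x 0 = planar (\<Phi> u)" "\<And>t. \<bar>t\<bar> < \<delta> \<Longrightarrow> x t \<in> profile"
    "\<And>t. \<bar>t\<bar> < \<delta> \<Longrightarrow> (x has_vector_derivative \<alpha> *\<^sub>R planar_K (x t)) (at t)"
proof -
  obtain B where B: "planar (\<Phi> u) \<in> B" "B \<subseteq> D" "level_flow_box planar_K r B"
    using profile_flow_box[OF u] by blast
  obtain J \<sigma> where \<sigma>: "integral_curve planar_K B J \<sigma>" "\<sigma> 0 = planar (\<Phi> u)"
    using level_flow_boxE[OF B(3) B(1) B(1) refl] by metis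
  have "planar (\<Phi> u) \<in> profile" using u by (auto simp: profile_def)
  then have \<sigma>_profile: "\<sigma> s \<in> profile" if "s \<in> J" for s
    using integral_curve_in_profile[OF integral_curve_mono[OF \<sigma>(1) B(2)] _ that] \<sigma>(2) by simp
  have \<sigma>': "(\<sigma> has_vector_derivative planar_K (\<sigma> s)) (at s)" if "s \<in> J" for s
    using \<sigma>(1) that by (simp add: integral_curve_def)
  have "open ((\<lambda>t. \<alpha> * t) -` J)"
    using \<sigma>(1) by (intro open_vimage continuous_intros) (simp add: integral_curve_def)
  moreover have "0 \<in> (\<lambda>t. \<alpha> * t) -` J" using \<sigma>(1) by (simp add: integral_curve_def)
  ultimately obtain \<delta> where \<delta>: "\<delta> > 0" "ball 0 \<delta> \<subseteq> (\<lambda>t. \<alpha> * t) -` J"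
    using open_contains_ball by metis
  then have J: "\<alpha> * t \<in> J" if "\<bar>t\<bar> < \<delta>" for t using that by (auto simp: subset_iff dist_real_def)
  show ?thesis
  proof (rule that[of \<delta> "\<lambda>t. \<sigma> (\<alpha> * t)"])
    fix t assume t: "\<bar>t\<bar> < \<delta>"
    show "\<sigma> (\<alpha> * t) \<in> profile" using \<sigma>_profile J t by blast
    have "((\<lambda>t. \<alpha> * t) has_vector_derivative \<alpha>) (at t)" by (auto intro!: derivative_eq_intros)
    from vector_diff_chain_at[OF this \<sigma>'[OF J[OF t]]]
    show "((\<lambda>t. \<sigma> (\<alpha> * t)) has_vector_derivative \<alpha> *\<^sub>R planar_K (\<sigma> (\<alpha> * t))) (at t)"
      by (simp add: o_def)
  qed (use \<delta>(1) \<sigma>(2) in auto)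
qed

end

locale orbit_great_circle = sss_hypersurface +
  fixes \<epsilon> \<alpha> :: real and x :: "real \<Rightarrow> real \<times> real" and \<theta> \<phi> \<theta>' \<phi>' :: "real \<Rightarrow> real"
  assumes \<epsilon>_pos: "\<epsilon> > 0" and \<alpha>_nonzero: "\<alpha> \<noteq> 0"
    and sphere: "sphere_geodesic_on {-\<epsilon><..<\<epsilon>} \<theta> \<phi> \<theta>' \<phi>'"
    and x_profile: "t \<in> {-\<epsilon><..<\<epsilon>} \<Longrightarrow> x t \<in> profile"
    and x_orbit: "t \<in> {-\<epsilon><..<\<epsilon>} \<Longrightarrow> (x has_vector_derivative \<alpha> *\<^sub>R planar_K (x t)) (at t)"
begin

abbreviation "I \<equiv> {-\<epsilon><..<\<epsilon>}"

definition curve :: "real \<Rightarrow> real^4" where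
  "curve t = chart_point (x t) (\<theta> t) (\<phi> t)"

definition velocity :: "real \<Rightarrow> real^4" where
  "velocity t = chart_point (\<alpha> *\<^sub>R planar_K (x t)) (\<theta>' t) (\<phi>' t)"

definition acceleration :: "real \<Rightarrow> real^4" where
  "acceleration t = chart_point (\<alpha> *\<^sub>R planar_K_derivative (x t) (\<alpha> *\<^sub>R planar_K (x t)))
     (sin (\<theta> t) * cos (\<theta> t) * (\<phi>' t)\<^sup>2) (- 2 * cos (\<theta> t) / sin (\<theta> t) * \<theta>' t * \<phi>' t)"

lemma curve_in_U: "t \<in> I \<Longrightarrow> curve t \<in> U"
  using x_profile[of t] profile_subset sphere
  by (auto simp: curve_def mem_chartdom_iff sphere_geodesic_on_def)

lemma curve_in_S: "t \<in> I \<Longrightarrow> curve t \<in> \<Phi> ` V"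
  unfolding mem_S_iff using x_profile[of t] curve_in_U[of t] by (simp add: curve_def)

lemma has_vector_derivative_curve: "t \<in> I \<Longrightarrow> (curve has_vector_derivative velocity t) (at t)"
  unfolding curve_def[abs_def] velocity_def using x_orbit[of t] sphere
  by (intro has_vector_derivative_chart_point) (auto simp: sphere_geodesic_on_def)

lemma has_vector_derivative_velocity:
  assumes t: "t \<in> I"
  shows "(velocity has_vector_derivative acceleration t) (at t)"
proof -
  have "x t \<in> D" using x_profile[OF t] profile_subset by blast
  note has_vector_derivative_planar_K[OF this x_orbit[OF t]]
  from bounded_linear.has_vector_derivative[OF bounded_linear_scaleR_right this] show ?thesis
    unfolding velocity_def[abs_def] acceleration_def using sphere t
    by (intro has_vector_derivative_chart_point) (simp_all add: sphere_geodesic_on_def)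
qed

lemma planar_velocity: "planar (velocity t) = \<alpha> *\<^sub>R planar (K (curve t))"
  by (simp add: curve_def velocity_def)

lemma gform_velocity:
  "gform G (curve t) (velocity t) (velocity t) = \<alpha>\<^sup>2 * gform G (curve t) (K (curve t)) (K (curve t))
     + lift2 gth (curve t) * ((\<theta>' t)\<^sup>2 + (sin (\<theta> t))\<^sup>2 * (\<phi>' t)\<^sup>2)"
proof -
  have "angular_norm_sq (curve t) (velocity t) = (\<theta>' t)\<^sup>2 + (sin (\<theta> t))\<^sup>2 * (\<phi>' t)\<^sup>2"
    by (simp add: angular_norm_sq_def curve_def velocity_def)
  then show ?thesis
    using gform_planar_scaleR(1)[OF planar_velocity K_simps(2,3), of "curve t" t] by simp
qed

lemma DERIV_gform_velocity:
  assumes t: "t \<in> I"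
  shows "((\<lambda>t. gform G (curve t) (velocity t) (velocity t)) has_real_derivative 0) (at t)"
proof -
  note p = curve_in_U[OF t] and deriv = has_vector_derivative_curve[OF t]
  have K_norm: "((\<lambda>t. gform G (curve t) (K (curve t)) (K (curve t))) has_real_derivative 0) (at t)"
    using has_real_derivative_differential[OF gform_differentiable[OF p K_nth_differentiable[OF p]]
      deriv]
      differential_K_norm_planar_scaleR_K[OF p planar_velocity] by simp
  have gth: "((\<lambda>t. lift2 gth (curve t)) has_real_derivative 0) (at t)"
    using has_real_derivative_differential[OF metric_lift2_differentiable(4)[OF p] deriv]
      differential_gth_planar_scaleR_K[OF p planar_velocity] by simp
  from DERIV_add[OF DERIV_cmult[OF K_norm]
      DERIV_mult[OF gth sphere_geodesic_DERIV_speed[OF sphere t]]]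
  show ?thesis by (simp add: gform_velocity)
qed

lemma gform_velocity_const:
  "t \<in> I \<Longrightarrow> gform G (curve t) (velocity t) (velocity t)
     = gform G (curve 0) (velocity 0) (velocity 0)"
  using DERIV_isconst3[of "-\<epsilon>" \<epsilon> t 0 "\<lambda>t. gform G (curve t) (velocity t) (velocity t)"]
    DERIV_gform_velocity \<epsilon>_pos by simp

lemma velocity_nonzero:
  assumes "t \<in> I"
  shows "velocity t \<noteq> 0"
proof -
  have "x t \<in> D" using x_profile[OF assms] profile_subset by blast
  then have "planar_K (x t) \<noteq> 0" using K_nonzero by (simp add: zero_prod_def)
  then show ?thesis
    using \<alpha>_nonzero
    by (auto simp: velocity_def vec_4_eq_iff_planar linear_0[OF linear_planar] zero_prod_def)
qed

lemma covariant_acceleration_curve_eq_0: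
  assumes t: "t \<in> I" and hess: "hess_form G (lift2 r) (curve t) (velocity t) = 0"
  shows "covariant_acceleration G (curve t) (velocity t) (acceleration t) = 0"
proof -
  let ?W = "covariant_acceleration G (curve t) (velocity t) (acceleration t)"
  note p = curve_in_U[OF t]
  obtain u where u: "u \<in> V" "curve t = \<Phi> u" using curve_in_S[OF t] by blast
  have "?W $ 3 = 0" "?W $ 4 = 0"
    unfolding covariant_acceleration_angular[OF p
      differential_gth_planar_scaleR_K[OF p planar_velocity]]
    by (simp_all add: acceleration_def velocity_def curve_def)
  moreover have "differential (lift2 r) (curve t) ?W = 0" "gform G (curve t) (K (curve t)) ?W = 0"
    using orbit_curve_acceleration_level[OF open_greaterThanLessThan t curve_in_U
        has_vector_derivative_curve planar_velocity has_vector_derivative_velocity[OF t]] hess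
    by simp_all
  ultimately show ?thesis
    using level_vector_orthogonal_K_eq_0[OF u(1)] by (simp add: u(2))
qed

lemma geodesic_curve:
  assumes photon: "\<And>u. u \<in> V \<Longrightarrow> photon_condition G (lift2 r) (lift2 gth) (\<Phi> u)"
    and null: "gform G (curve 0) (velocity 0) (velocity 0) = 0"
  shows "geodesic G U I curve"
proof -
  have "covariant_acceleration G (curve t) (velocity t) (acceleration t) = 0" if t: "t \<in> I" for t
  proof (rule covariant_acceleration_curve_eq_0[OF t])
    obtain u where u: "u \<in> V" "curve t = \<Phi> u" using curve_in_S[OF t] by blast
    have "velocity t \<in> tangent_space \<Phi> u"
      using differential_r_planar_scaleR_K[OF curve_in_U[OF t] planar_velocity[of t]]
        tangent_space_eq[OF u(1)] by (simp add: u(2))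
    then show "hess_form G (lift2 r) (curve t) (velocity t) = 0"
      using photon_condition_iff_hess_form_tangent[OF u(1) _ velocity_nonzero[OF t]] photon[OF u(1)]
        gform_velocity_const[OF t] null by (simp add: u(2))
  qed
  then show ?thesis
    unfolding geodesic_iff_covariant_acceleration
    using curve_in_U has_vector_derivative_curve has_vector_derivative_velocity by blast
qed

end

context sss_hypersurface
begin

lemma photon_condition_imp_null_geodesic:
  assumes photon: "\<And>u. u \<in> V \<Longrightarrow> photon_condition G (lift2 r) (lift2 gth) (\<Phi> u)"
    and u: "u \<in> V" and k: "k \<in> tangent_space \<Phi> u" "k \<noteq> 0" "gform G (\<Phi> u) k k = 0"
  obtains \<epsilon> \<gamma> where "\<epsilon> > 0" "geodesic G U {-\<epsilon><..<\<epsilon>} \<gamma>" "\<gamma> 0 = \<Phi> u"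
    "(\<gamma> has_vector_derivative k) (at 0)" "\<gamma> ` {-\<epsilon><..<\<epsilon>} \<subseteq> \<Phi> ` V"
proof -
  define p where "p = \<Phi> u"
  have p: "p \<in> U" using immersed(2) u by (auto simp: p_def)
  obtain \<alpha> where \<alpha>: "planar k = \<alpha> *\<^sub>R planar (K p)"
    using tangent_planar_scaleR_K[OF u] k(1) tangent_space_eq[OF u] by (auto simp: p_def)
  have null: "\<alpha>\<^sup>2 * gform G p (K p) (K p) + lift2 gth p * angular_norm_sq p k = 0"
    using k(3) gform_planar_scaleR(1)[OF \<alpha>, of p] by (simp add: p_def)
  have "\<alpha> \<noteq> 0" using null_vector_planar_nonzero[OF p _ k(2)] k(3) \<alpha>
    by (auto simp: p_def zero_prod_def)
  moreover have "(k $ 3, k $ 4) \<noteq> (0, 0)"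
    using null \<open>\<alpha> \<noteq> 0\<close> K_timelike[OF u] by (auto simp: angular_norm_sq_def p_def)
  moreover have "0 < p $ 3" "p $ 3 < pi" using p by (auto simp: mem_chartdom_iff)
  ultimately obtain \<epsilon>1 \<theta> \<phi> \<theta>' \<phi>' where "\<epsilon>1 > 0"
    and sphere: "sphere_geodesic_on {-\<epsilon>1<..<\<epsilon>1} \<theta> \<phi> \<theta>' \<phi>'"
    and init: "\<theta> 0 = p $ 3" "\<phi> 0 = p $ 4" "\<theta>' 0 = k $ 3" "\<phi>' 0 = k $ 4"
    using sphere_geodesic_exists by metis
  obtain \<delta> x where "\<delta> > 0" and x: "x 0 = planar p" "\<And>t. \<bar>t\<bar> < \<delta> \<Longrightarrow> x t \<in> profile"
    "\<And>t. \<bar>t\<bar> < \<delta> \<Longrightarrow> (x has_vector_derivative \<alpha> *\<^sub>R planar_K (x t)) (at t)"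
    using profile_orbit_exists[OF u] unfolding p_def by blast
  define \<epsilon> where "\<epsilon> = min \<epsilon>1 \<delta>"
  have \<epsilon>: "\<epsilon> > 0" "{-\<epsilon><..<\<epsilon>} \<subseteq> {-\<epsilon>1<..<\<epsilon>1}" "\<And>t. t \<in> {-\<epsilon><..<\<epsilon>} \<Longrightarrow> \<bar>t\<bar> < \<delta>"
    using \<open>\<epsilon>1 > 0\<close> \<open>\<delta> > 0\<close> by (auto simp: \<epsilon>_def)
  interpret orbit_great_circle D g00 g01 g11 gth r K0 K1 \<Phi> V \<epsilon> \<alpha> x \<theta> \<phi> \<theta>' \<phi>'
    using \<epsilon>(1) \<open>\<alpha> \<noteq> 0\<close> sphere_geodesic_on_subset[OF sphere \<epsilon>(2)] x(2,3)[OF \<epsilon>(3)]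
    by unfold_locales
  have "curve 0 = p" "velocity 0 = k"
    using \<alpha> by (simp_all add: curve_def velocity_def vec_4_eq_iff_planar x(1) init)
  moreover from this have "geodesic G U {-\<epsilon><..<\<epsilon>} curve"
    using geodesic_curve[OF photon] k(3) by (simp add: p_def)
  moreover have "curve ` {-\<epsilon><..<\<epsilon>} \<subseteq> \<Phi> ` V" using curve_in_S by blast
  ultimately show ?thesis
    using that[of \<epsilon> curve] \<epsilon>(1) has_vector_derivative_curve[of 0] by (simp add: p_def)
qed

lemma photon_surface_iff_photon_condition:
  "photon_surface G U \<Phi> V \<longleftrightarrow> (\<forall>u\<in>V. photon_condition G (lift2 r) (lift2 gth) (\<Phi> u))"
proof
  assume "photon_surface G U \<Phi> V"
  then show "\<forall>u\<in>V. photon_condition G (lift2 r) (lift2 gth) (\<Phi> u)"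
    using photon_surface_imp_photon_condition by blast
next
  assume photon: "\<forall>u\<in>V. photon_condition G (lift2 r) (lift2 gth) (\<Phi> u)"
  have "nowhere_spacelike G \<Phi> V"
    unfolding nowhere_spacelike_def
  proof
    fix u assume "u \<in> V"
    then show "\<exists>v\<in>tangent_space \<Phi> u. v \<noteq> 0 \<and> gform G (\<Phi> u) v v \<le> 0"
      using null_tangent_vector_exists by (metis order.refl)
  qed
  moreover have "immersed_hypersurface U \<Phi> V"
    using S_timelike by (simp add: timelike_hypersurface_def)
  moreover have "\<exists>\<epsilon>>0. \<exists>\<gamma>. geodesic G U {-\<epsilon><..<\<epsilon>} \<gamma> \<and> \<gamma> 0 = \<Phi> u \<and>
      (\<gamma> has_vector_derivative k) (at 0) \<and> \<gamma> ` {-\<epsilon><..<\<epsilon>} \<subseteq> \<Phi> ` V"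
    if "u \<in> V" "k \<in> tangent_space \<Phi> u" "k \<noteq> 0" "gform G (\<Phi> u) k k = 0" for u k
    using photon_condition_imp_null_geodesic[OF bspec[OF photon] that] by metis
  ultimately show "photon_surface G U \<Phi> V" unfolding photon_surface_def by blast
qed

end

theorem theorem4:
  fixes D :: "(real \<times> real) set"
    and g00 g01 g11 gth r K0 K1 :: "real \<times> real \<Rightarrow> real"
    and \<Phi> :: "real^3 \<Rightarrow> real^4" and V :: "(real^3) set"
  defines "U \<equiv> chartdom D"
    and "G \<equiv> sss_metric g00 g01 g11 gth"
    and "K \<equiv> vf2 K0 K1"
  assumes D_open: "open D"
    and smooth: "smooth_fun D g00" "smooth_fun D g01" "smooth_fun D g11" "smooth_fun D gth"
      "smooth_fun D r"
    and pos: "\<forall>x\<in>D. g00 x > 0 \<and> g01 x > 0 \<and> g11 x > 0 \<and> gth x > 0"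
    and lorentzian: "\<forall>x\<in>D. g00 x * g11 x - (g01 x)\<^sup>2 < 0"
    and gth_fun_r: "\<exists>h :: real \<Rightarrow> real. \<forall>x\<in>D. gth x = h (r x)"
    and K_smooth: "smooth_fun D K0" "smooth_fun D K1"
    and K_nonzero: "\<forall>x\<in>D. (K0 x, K1 x) \<noteq> (0, 0)"
    and K_killing: "killing_field G U K"
    and K_hso: "hypersurface_orthogonal G U K"
    and r_invariant: "\<forall>p\<in>U. (\<Sum>k\<in>UNIV. K p $ k * partial k (lift2 r) p) = 0"
    and S_timelike: "timelike_hypersurface G U \<Phi> V"
    and S_so3: "so3_invariant U (\<Phi> ` V)"
    and S_R: "flow_invariant K U (\<Phi> ` V)"
    and grad_r: "\<forall>u\<in>V. gradient G (lift2 r) (\<Phi> u) \<noteq> 0"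
  shows "(so3_invariant U (\<Phi> ` V) \<and> flow_invariant K U (\<Phi> ` V) \<and> photon_surface G U \<Phi> V)
     \<longleftrightarrow> (\<forall>u\<in>V. photon_condition G (lift2 r) (lift2 gth) (\<Phi> u))"
proof -
  interpret sss_hypersurface D g00 g01 g11 gth r K0 K1 \<Phi> V
    by unfold_locales (use assms in \<open>auto simp: differential_def mult.commute\<close>)
  show ?thesis
    using photon_surface_iff_photon_condition S_so3 S_R unfolding U_def G_def K_def by blast
qed

end
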